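(* Let $d\in\mathbb{N}^{+}\cup\{\infty\}$, $\eta>0$, $h>0$, $r\in(0,1]$, and $\alpha\in \mathrm{DC}^{d}$. Suppose that $$v(x)=\sum_{\mathbf{k}\in\Gamma_{r}}\widehat{v}_{\mathbf{k}}\,\mathrm{e}^{\mathrm{i}\langle\mathbf{k},x\rangle}\in C^{\omega}(\mathbb{T}^{d}_{h},\mathbb{C}).$$ Then there exists $\lambda_{0}=\lambda_{0}(\eta,h,r,\alpha,\|v\|_{h})>0$ such that for every $\lambda\in\mathbb{R}$ with $|\lambda|<\lambda_{0}$ one has $\Sigma_{\lambda v,\alpha}=[-2,2]$.
   Context: Torus: $\mathbb{T}=\mathbb{R}/2\pi\mathbb{Z}$, $\mathbb{T}^d=(\mathbb{R}/2\pi\mathbb{Z})^d$, with $d\in\mathbb{N}^+\cup\{\infty\}$; coordinates are indexed by integers $1\le j\le d$ (all $j\ge1$ if $d=\infty$), and $\langle j\rangle=\max\{1,j\}$. For an integer vector $\mathbf{k}=(\mathbf{k}_j)$ and fixed $\eta>0$, $|\mathbf{k}|_\eta=\sum_j\langle j\rangle^\eta|\mathbf{k}_j|$, and $\mathbb{Z}^d_*=\{\mathbf{k}\in\mathbb{Z}^d: 0<|\mathbf{k}|_\eta<\infty\}$. $\mathbb{T}^d_h=\{x\in\mathbb{C}^d:\mathrm{Re}\,x_j\in\mathbb{T},\ |\mathrm{Im}\,x_j|<h\langle j\rangle^\eta\}$. $C^\omega(\mathbb{T}^d_h,\mathbb{C})$ is the space of functions $v(x)=\sum_{\mathbf{k}\in\mathbb{Z}^d_*\cup\{0\}}\widehat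 v_{\mathbf{k}}\mathrm{e}^{\mathrm{i}\langle\mathbf{k},x\rangle}$ with $\|v\|_h=\sum_{\mathbf{k}}|\widehat v_{\mathbf{k}}|\mathrm{e}^{h|\mathbf{k}|_\eta}<\infty$. Cone: fix weights $w_j>0$ with $\sum_j w_j=1$; $\Gamma_r=\{\mathbf{k}\in\mathbb{Z}^d_*:\ \sum_j\langle j\rangle^\eta\mathbf{k}_jw_j\ge r|\mathbf{k}|_\eta\}$. Diophantine frequencies: for $\gamma\in(0,1)$ and fixed $\tau>1$, $\mathrm{DC}^d_{\gamma,\tau}$ is the set of $\alpha\in[1,2]^d$ with $\inf_{n\in\mathbb{Z}}|\langle\mathbf{k},\alpha\rangle-2\pi n|\ge\gamma\prod_j\frac{1}{1+\langle j\rangle^\tau|\mathbf{k}_j|^\tau}$ for all $\mathbf{k}\in\mathbb{Z}^d_*$; $\mathrm{DC}^d=\bigcup_{\gamma>0}\mathrm{DC}^d_{\gamma,\tau}$. Operator: on $\ell^2(\mathbb{Z})$ (complex sequences), $(H_{\lambda v,\alpha,x}\psi)_n=\psi_{n+1}+\psi_{n-1}+\lambda v(x+n\alpha)\psi_n$, $x\in\mathbb{T}^d$. Its spectrum does not depend on $x$ and is denoted $\Sigma_{\lambda v,\alpha}$. *)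

theory Defs
  imports "HOL-Analysis.Analysis" "HOL-Library.Extended_Nat"
begin

definition indices :: "enat \<Rightarrow> nat set" where
  "indices d = {j. 1 \<le> j \<and> enat j \<le> d}"

text \<open>The power \<open>A\<^sup>d\<close>, where \<open>d = \<infinity>\<close> is allowed. A tuple is a function on all of \<^typ>\<open>nat\<close> that
  vanishes off the index set, so sums over coordinates below can range over all \<open>j\<close>.\<close>

definition tuples :: "enat \<Rightarrow> 'a::zero set \<Rightarrow> (nat \<Rightarrow> 'a) set" where
  "tuples d A = {x. (\<forall>j\<in>indices d. x j \<in> A) \<and> (\<forall>j. j \<notin> indices d \<longrightarrow> x j = 0)}"

definition jap :: "nat \<Rightarrow> real" where
  "jap j = max 1 (real j)"

definition eta_norm :: "real \<Rightarrow> (nat \<Rightarrow> int) \<Rightarrow> real" where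
  "eta_norm \<eta> k = (\<Sum>\<^sub>\<infinity>j. jap j powr \<eta> * \<bar>real_of_int (k j)\<bar>)"

text \<open>Summability expresses that the \<open>\<eta>\<close>-norm is finite. For \<open>\<eta> > 0\<close> it forces \<open>k\<close> to have finite
  support, since all nonzero terms are at least 1.\<close>

definition Zstar :: "enat \<Rightarrow> real \<Rightarrow> (nat \<Rightarrow> int) set" where
  "Zstar d \<eta> = {k \<in> tuples d UNIV.
     (\<lambda>j. jap j powr \<eta> * \<bar>real_of_int (k j)\<bar>) summable_on UNIV \<and> 0 < eta_norm \<eta> k}"

definition pairing :: "(nat \<Rightarrow> int) \<Rightarrow> (nat \<Rightarrow> 'a) \<Rightarrow> 'a::real_normed_field" where
  "pairing k x = (\<Sum>\<^sub>\<infinity>j. of_int (k j) * x j)"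

text \<open>The strip around the torus, as a subset of the universal cover; functions on it given by
  Fourier series are automatically \<open>2\<pi>\<close>-periodic in each coordinate.\<close>

definition strip :: "enat \<Rightarrow> real \<Rightarrow> real \<Rightarrow> (nat \<Rightarrow> complex) set" where
  "strip d \<eta> h = {x \<in> tuples d UNIV. \<forall>j\<in>indices d. \<bar>Im (x j)\<bar> < h * jap j powr \<eta>}"

text \<open>\<open>C_omega d \<eta> h v c\<close>: the function \<open>v\<close> belongs to \<open>C\<^sup>\<omega>\<close> of the strip, with Fourier
  coefficients \<open>c\<close>; \<open>coeff_norm d \<eta> h c\<close> is then the norm of \<open>v\<close>.\<close>

definition C_omega ::
  "enat \<Rightarrow> real \<Rightarrow> real \<Rightarrow> ((nat \<Rightarrow> complex) \<Rightarrow> complex) \<Rightarrow> ((nat \<Rightarrow> int) \<Rightarrow> complex) \<Rightarrow> bool" where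
  "C_omega d \<eta> h v c \<longleftrightarrow>
     (\<lambda>k. cmod (c k) * exp (h * eta_norm \<eta> k)) summable_on (Zstar d \<eta> \<union> {\<lambda>_. 0}) \<and>
     (\<forall>x\<in>strip d \<eta> h. ((\<lambda>k. c k * exp (\<i> * pairing k x)) has_sum v x) (Zstar d \<eta> \<union> {\<lambda>_. 0}))"

definition coeff_norm :: "enat \<Rightarrow> real \<Rightarrow> real \<Rightarrow> ((nat \<Rightarrow> int) \<Rightarrow> complex) \<Rightarrow> real" where
  "coeff_norm d \<eta> h c =
     (\<Sum>\<^sub>\<infinity>k\<in>Zstar d \<eta> \<union> {\<lambda>_. 0}. cmod (c k) * exp (h * eta_norm \<eta> k))"

definition weights :: "enat \<Rightarrow> (nat \<Rightarrow> real) \<Rightarrow> bool" where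
  "weights d w \<longleftrightarrow> w \<in> tuples d {0<..} \<and> (w has_sum 1) UNIV"

definition weighted_cone :: "enat \<Rightarrow> real \<Rightarrow> (nat \<Rightarrow> real) \<Rightarrow> real \<Rightarrow> (nat \<Rightarrow> int) set" where
  "weighted_cone d \<eta> w r = {k \<in> Zstar d \<eta>.
     (\<Sum>\<^sub>\<infinity>j. jap j powr \<eta> * real_of_int (k j) * w j) \<ge> r * eta_norm \<eta> k}"

text \<open>The product over all coordinates reduces to the finite support of \<open>k\<close>, because the
  factors with \<open>k j = 0\<close> are 1.\<close>

definition DC_gamma :: "enat \<Rightarrow> real \<Rightarrow> real \<Rightarrow> real \<Rightarrow> (nat \<Rightarrow> real) set" where
  "DC_gamma d \<eta> \<gamma> \<tau> = {\<alpha> \<in> tuples d {1..2}. \<forall>k\<in>Zstar d \<eta>.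
     (INF n::int. \<bar>pairing k \<alpha> - 2 * pi * real_of_int n\<bar>)
       \<ge> \<gamma> * (\<Prod>j | k j \<noteq> 0. 1 / (1 + jap j powr \<tau> * \<bar>real_of_int (k j)\<bar> powr \<tau>))}"

definition DC :: "enat \<Rightarrow> real \<Rightarrow> real \<Rightarrow> (nat \<Rightarrow> real) set" where
  "DC d \<eta> \<tau> = (\<Union>\<gamma>\<in>{0<..}. DC_gamma d \<eta> \<gamma> \<tau>)"

definition ell2 :: "(int \<Rightarrow> complex) set" where
  "ell2 = {\<psi>. (\<lambda>n. (cmod (\<psi> n))\<^sup>2) summable_on UNIV}"

definition ell2_norm :: "(int \<Rightarrow> complex) \<Rightarrow> real" where
  "ell2_norm \<psi> = sqrt (\<Sum>\<^sub>\<infinity>n. (cmod (\<psi> n))\<^sup>2)"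

definition bounded_operator :: "((int \<Rightarrow> complex) \<Rightarrow> (int \<Rightarrow> complex)) \<Rightarrow> bool" where
  "bounded_operator T \<longleftrightarrow>
     (\<forall>\<psi>\<in>ell2. T \<psi> \<in> ell2) \<and>
     (\<forall>\<psi>\<in>ell2. \<forall>\<phi>\<in>ell2. T (\<lambda>n. \<psi> n + \<phi> n) = (\<lambda>n. T \<psi> n + T \<phi> n)) \<and>
     (\<forall>a. \<forall>\<psi>\<in>ell2. T (\<lambda>n. a * \<psi> n) = (\<lambda>n. a * T \<psi> n)) \<and>
     (\<exists>C. \<forall>\<psi>\<in>ell2. ell2_norm (T \<psi>) \<le> C * ell2_norm \<psi>)"

text \<open>The complement of the set of \<open>z\<close> for which \<open>T - z\<close> has a bounded two-sided inverse.\<close>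

definition spectrum :: "((int \<Rightarrow> complex) \<Rightarrow> (int \<Rightarrow> complex)) \<Rightarrow> complex set" where
  "spectrum T = {z. \<not> (\<exists>R. bounded_operator R \<and>
     (\<forall>\<psi>\<in>ell2. R (\<lambda>n. T \<psi> n - z * \<psi> n) = \<psi> \<and> (\<lambda>n. T (R \<psi>) n - z * R \<psi> n) = \<psi>))}"

definition schroedinger :: "((nat \<Rightarrow> complex) \<Rightarrow> complex) \<Rightarrow> (nat \<Rightarrow> real) \<Rightarrow> (nat \<Rightarrow> real) \<Rightarrow>
    (int \<Rightarrow> complex) \<Rightarrow> (int \<Rightarrow> complex)" where
  "schroedinger v \<alpha> x \<psi> = (\<lambda>n. \<psi> (n + 1) + \<psi> (n - 1)
     + v (\<lambda>j. complex_of_real (x j + real_of_int n * \<alpha> j)) * \<psi> n)"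

end

theory Submission imports Defs begin

text \<open>The Fourier exponents of the potential lie in a cone, so sums of them never return to \<open>0\<close>, and
  the perturbation series around a plane wave \<open>t\<^sup>n\<close> is triangular: its term for a word \<open>k\<^sub>1, \<dots>, k\<^sub>m\<close> is
  a product of Fourier coefficients divided by the values of the free symbol, minus the energy
  \<open>E = z + 1 / z\<close>, at the frequencies of the partial sums. This divisor is a product of two distances
  from points of the circle to fixed points \<open>a\<close> and \<open>b\<close>. The Diophantine condition separates the partial
  sums, so only a small proportion of the distances to \<open>a\<close> is small, and the product of all of them is
  at least \<open>C exp (- m x0 - h / 2 * \<Sum>\<bar>k\<^sub>i\<bar>)\<close>, where \<open>x0\<close> does not depend on \<open>a\<close>. Hence for small coupling
  the series converges for all energies at once.

  For \<open>E\<close> off \<open>[-2, 2]\<close>, i.e. \<open>0 < \<bar>z\<bar> < 1\<close>, the series with \<open>t = z\<close> and \<open>t = 1 / z\<close> are solutions decaying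
  at \<open>+\<infinity>\<close> and \<open>-\<infinity>\<close> with Wronskian \<open>z - 1 / z\<close>, and they give a Green function. For \<open>x = 2 cos \<theta>\<close> the
  series with \<open>t = e\<^sup>i\<^sup>\<theta>\<close> at the energy \<open>x + i\<delta>\<close> is a bounded solution of an equation with right-hand
  side of size \<open>\<delta>\<close> that has a mode of size 1, so \<open>H - x\<close> has no bounded inverse.\<close>

text \<open>The potential may be complex, so the operator need not be self-adjoint and nothing
  forces its spectrum to be real: every complex energy has to be treated, with one coupling
  threshold for all of them. The obstacle is that zeros of the symbol move with the energy and may
  come arbitrarily close to the unit circle, at points about which the Diophantine condition says
  nothing. Two devices deal with this. Most divisors are estimated through mutual distances of
  frequencies, which \<alpha> does control; only the worst single divisor depends on the position of
  the zero, and it contributes a factor to the whole series that does not affect convergence.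
  Moreover no series is formed at a real energy of the interval: the shift \<delta> is fixed by the
  norm of the supposed inverse and never tends to 0, so the energy-dependent zeros stay off the
  circle and that factor is finite.\<close>

no_notation Infinite_Set_Sum.abs_summable_on (infix \<open>abs'_summable'_on\<close> 50)

subsection \<open>Products of small divisors\<close>

text \<open>Along \<open>J\<close> in increasing order \<open>p\<close> drops by at least
  \<open>M\<close> at each of the \<open>card J - 1\<close> steps, and the drops telescope.\<close>

lemma card_separated_le:
  fixes p :: "nat \<Rightarrow> real"
  assumes "finite J" "J \<noteq> {}"
    and "\<And>i j. i \<in> J \<Longrightarrow> j \<in> J \<Longrightarrow> i < j \<Longrightarrow> M \<le> p i - p j"
  shows "(real (card J) - 1) * M \<le> p (Min J) - p (Max J)"
  using assms
proof (induction J rule: finite_linorder_max_induct)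
  case empty
  then show ?case by simp
next
  case (insert b A)
  show ?case
  proof (cases "A = {}")
    case True
    then show ?thesis by simp
  next
    case False
    have "b \<notin> A" using insert.hyps(2) by blast
    have mx: "Max (insert b A) = b" "Min (insert b A) = Min A"
      using insert.hyps False by (auto intro!: Max_eqI Min_eqI less_imp_le Min_in)
    have "(real (card A) - 1) * M \<le> p (Min A) - p (Max A)"
      using insert False by auto
    moreover have "M \<le> p (Max A) - p b"
      using insert False by auto
    moreover have "(real (card (insert b A)) - 1) * M = (real (card A) - 1) * M + M"
      using \<open>b \<notin> A\<close> insert.hyps(1) by (simp add: algebra_simps)
    ultimately show ?thesis unfolding mx by linarith
  qed
qed

lemma tail_sum_powr_small:
  fixes q \<epsilon> :: real
  assumes "1 < q" "0 < \<epsilon>"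
  obtains x0 :: nat where "1 \<le> x0" "\<And>X. (\<Sum>x=x0..<X. real x powr (-q)) \<le> \<epsilon>"
proof -
  have s: "summable (\<lambda>x::nat. real x powr (-q))"
    using assms summable_real_powr_iff[of "-q"] by simp
  obtain n0 where n0: "\<And>m n. m \<ge> n0 \<Longrightarrow> norm (\<Sum>x=m..<n. real x powr (-q)) < \<epsilon>"
    using s assms unfolding summable_Cauchy by blast
  show ?thesis
  proof (rule that[of "max 1 n0"])
    fix X
    show "(\<Sum>x=max 1 n0..<X. real x powr (-q)) \<le> \<epsilon>"
      using n0[of "max 1 n0" X] by simp
  qed simp
qed

text \<open>Layer cake: by the premise on \<open>min (L i) (L j)\<close> two points \<open>i < j\<close> with \<open>L > x\<close> satisfy
  \<open>p i - p j > (x / B) powr (1 / \<beta>)\<close>, so there are at most \<open>1 + P / (x / B) powr (1 / \<beta>)\<close> such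
  points, and this is summable in \<open>x\<close> because \<open>\<beta> < 1\<close>.\<close>

lemma sum_separated_bound:
  fixes B \<beta> \<kappa> :: real
  assumes B: "0 < B" and \<beta>: "0 < \<beta>" "\<beta> < 1" and \<kappa>: "0 < \<kappa>"
  obtains x0 :: real where "0 \<le> x0"
    "\<And>n p L P F. \<lbrakk>\<And>i. i < n \<Longrightarrow> 0 \<le> p i \<and> p i \<le> P; 0 \<le> P; 0 \<le> F;
       \<And>i j. i < j \<Longrightarrow> j < n \<Longrightarrow> p j < p i \<and> min (L i) (L j) \<le> B * (p i - p j) powr \<beta>;
       \<And>i. i < n \<Longrightarrow> L i \<le> F\<rbrakk>
      \<Longrightarrow> (\<Sum>i<n. L i) \<le> real n * x0 + \<kappa> * P + F + (1::real)"
proof -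
  define q where "q = 1 / \<beta>"
  define C where "C = B powr q"
  have q: "1 < q" using \<beta> by (simp add: q_def)
  have C: "0 < C" using B by (simp add: C_def)
  \<comment> \<open>The tail gets multiplied by \<open>P * C\<close> below, so this tolerance turns
    it into \<open>\<kappa> * P\<close>. A positive threshold keeps every level in use
    positive.\<close>
  obtain x0 :: nat where x0: "1 \<le> x0" "\<And>X. (\<Sum>x=x0..<X. real x powr (-q)) \<le> \<kappa> / C"
    using tail_sum_powr_small[OF q, of "\<kappa> / C"] \<kappa> C by auto
  show ?thesis
  proof (rule that[of "real x0"])
    fix n :: nat and p L :: "nat \<Rightarrow> real" and P F :: real
    assume p: "\<And>i. i < n \<Longrightarrow> 0 \<le> p i \<and> p i \<le> P" and P: "0 \<le> P" and F: "0 \<le> F"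
      and sep: "\<And>i j. i < j \<Longrightarrow> j < n \<Longrightarrow> p j < p i \<and> min (L i) (L j) \<le> B * (p i - p j) powr \<beta>"
      and LF: "\<And>i. i < n \<Longrightarrow> L i \<le> F"
    \<comment> \<open>No \<open>L i\<close> exceeds \<open>F\<close>, so integer levels below
      \<open>X\<close> suffice; rounding up costs the final \<open>+ 1\<close>.\<close>
    define X where "X = nat \<lceil>F\<rceil>"
    have X: "F \<le> real X" "real X \<le> F + 1"
      unfolding X_def using F by linarith+
    define J where "J x = {i. i < n \<and> L i > real x}" for x :: nat
    have finJ: "finite (J x)" for x by (simp add: J_def)
    have cardJ: "real (card (J x)) \<le> 1 + P * C * real x powr (-q)" if x: "x \<ge> x0" for x
    proof (cases "J x = {}")
      case True
      then show ?thesis using P C by simp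
    next
      case False
      have xpos: "real x > 0" using x x0(1) by linarith
      define M where "M = (real x / B) powr q"
      have Mpos: "M > 0" using xpos B by (simp add: M_def)
      have "M \<le> p i - p j" if ij: "i \<in> J x" "j \<in> J x" "i < j" for i j
      proof -
        have j: "j < n" using ij by (simp add: J_def)
        have "real x < min (L i) (L j)" using ij by (simp add: J_def)
        also have "\<dots> \<le> B * (p i - p j) powr \<beta>" using sep[OF ij(3) j] by simp
        finally have "real x / B < (p i - p j) powr \<beta>"
          using B by (simp add: field_simps)
        then have "(real x / B) powr q \<le> ((p i - p j) powr \<beta>) powr q"
          using xpos B q by (intro powr_mono2) auto
        also have "\<dots> = p i - p j"
          using sep[OF ij(3) j] \<beta> by (simp add: powr_powr q_def)
        finally show ?thesis by (simp add: M_def)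
      qed
      then have "(real (card (J x)) - 1) * M \<le> p (Min (J x)) - p (Max (J x))"
        using card_separated_le[OF finJ False] by blast
      also have "\<dots> \<le> P"
      proof -
        have "Min (J x) < n" "Max (J x) < n"
          using Min_in[OF finJ False] Max_in[OF finJ False] by (auto simp: J_def)
        then show ?thesis using p[of "Min (J x)"] p[of "Max (J x)"] by linarith
      qed
      finally have "real (card (J x)) \<le> 1 + P * (1 / M)"
        using Mpos by (simp add: field_simps)
      also have "1 / M = C * real x powr (-q)"
        using xpos B by (simp add: M_def C_def powr_divide powr_minus_divide)
      finally show ?thesis by simp
    qed
    \<comment> \<open>Levels below \<open>x0\<close> are paid in full, once per index, which yields
      \<open>real n * x0\<close>; above \<open>x0\<close> the integer levels exceeded by
      \<open>L i\<close> are counted.\<close>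
    have Li: "L i \<le> real x0 + (\<Sum>x=x0..<X. of_bool (real x < L i))" if "i < n" for i
    proof (cases "L i \<le> real x0")
      case True
      moreover have "(\<Sum>x=x0..<X. of_bool (real x < L i)) \<ge> (0::real)"
        by (intro sum_nonneg) auto
      ultimately show ?thesis by linarith
    next
      case False
      define m where "m = nat \<lceil>L i\<rceil>"
      have m: "L i \<le> real m" "real m < L i + 1"
        unfolding m_def using False by linarith+
      have mX: "m \<le> X" unfolding m_def X_def using LF[OF that] by (intro nat_mono ceiling_mono)
      have mx0: "x0 < m" using m False by linarith
      have "real m - real x0 = (\<Sum>x=x0..<m. 1)" using mx0 by simp
      also have "\<dots> = (\<Sum>x=x0..<m. of_bool (real x < L i))"
      proof (rule sum.cong)
        fix x assume "x \<in> {x0..<m}"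
        then have "real x + 1 \<le> real m" by auto
        then have "real x < L i" using m by linarith
        then show "1 = of_bool (real x < L i)" by simp
      qed simp
      also have "\<dots> \<le> (\<Sum>x=x0..<X. of_bool (real x < L i))"
        using mX by (intro sum_mono2) auto
      finally show ?thesis using m by linarith
    qed
    have "(\<Sum>i<n. L i) \<le> (\<Sum>i<n. real x0 + (\<Sum>x=x0..<X. of_bool (real x < L i)))"
      using Li by (intro sum_mono) auto
    also have "\<dots> = real n * real x0 + (\<Sum>x=x0..<X. \<Sum>i<n. of_bool (real x < L i))"
      unfolding sum.distrib by (subst sum.swap) (simp only: sum_constant card_lessThan)
    also have "(\<Sum>x=x0..<X. \<Sum>i<n. of_bool (real x < L i)) = (\<Sum>x=x0..<X. real (card (J x)))"
    proof (rule sum.cong)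
      fix x
      have "(\<Sum>i<n. of_bool (real x < L i)) = real (card ({..<n} \<inter> {i. real x < L i}))"
        by (simp add: sum.If_cases of_bool_def)
      also have "{..<n} \<inter> {i. real x < L i} = J x" by (auto simp: J_def)
      finally show "(\<Sum>i<n. of_bool (real x < L i)) = real (card (J x))" .
    qed simp
    also have "\<dots> \<le> (\<Sum>x=x0..<X. 1 + P * C * real x powr (-q))"
      using cardJ by (intro sum_mono) auto
    also have "\<dots> = real (X - x0) + P * C * (\<Sum>x=x0..<X. real x powr (-q))"
      by (simp add: sum.distrib sum_distrib_left)
    also have "\<dots> \<le> (F + 1) + P * C * (\<kappa> / C)"
      using x0(2)[of X] P C X(2) by (intro add_mono mult_left_mono) auto
    also have "\<dots> = F + 1 + \<kappa> * P" using C by simp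
    finally show "(\<Sum>i<n. L i) \<le> real n * real x0 + \<kappa> * P + F + 1" by simp
  qed simp
qed

text \<open>A sublinear loss costs arbitrarily little per unit of weight, at the price of an
  additive constant. This turns the Diophantine bound into a floor of slope \<open>\<kappa>\<close>
  in \<open>apart_1\<close>.\<close>

lemma powr_le_linear:
  fixes B \<beta> \<kappa> :: real
  assumes "0 \<le> B" "0 < \<beta>" "\<beta> < 1" "0 < \<kappa>"
  obtains C where "0 \<le> C" "\<And>x. 0 \<le> x \<Longrightarrow> B * x powr \<beta> \<le> \<kappa> * x + C"
proof -
  \<comment> \<open>Beyond \<open>y\<close> the factor \<open>x powr (1 - \<beta>)\<close> beats
    \<open>B / \<kappa>\<close>, and up to \<open>y\<close> the constant suffices. Taking
    \<open>B + 1\<close> keeps \<open>y\<close> positive for \<open>B = 0\<close>.\<close>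
  define y where "y = ((B + 1) / \<kappa>) powr (1 / (1 - \<beta>))"
  have y: "y > 0" using assms by (simp add: y_def)
  have "B * x powr \<beta> \<le> \<kappa> * x + B * y powr \<beta>" if x: "0 \<le> x" for x
  proof (cases "x \<le> y")
    case True
    then have "B * x powr \<beta> \<le> B * y powr \<beta>"
      using x assms by (intro mult_left_mono powr_mono2) auto
    then show ?thesis using x assms by (simp add: add_increasing)
  next
    case False
    then have xp: "x > 0" using y by linarith
    have "(B + 1) / \<kappa> = y powr (1 - \<beta>)"
      using assms by (simp add: y_def powr_powr)
    also have "\<dots> \<le> x powr (1 - \<beta>)" using False y assms by (intro powr_mono2) auto
    finally have "B \<le> \<kappa> * x powr (1 - \<beta>)" using assms by (simp add: field_simps)
    then have "B * x powr \<beta> \<le> \<kappa> * x powr (1 - \<beta>) * x powr \<beta>"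
      by (intro mult_right_mono) auto
    also have "\<dots> = \<kappa> * x"
      using xp by (simp add: mult.assoc flip: powr_add)
    finally show ?thesis using assms by (simp add: add_increasing2)
  qed
  then show ?thesis using that[of "B * y powr \<beta>"] assms by auto
qed

section \<open>Frequencies and weights of words\<close>

abbreviation wt :: "('k \<Rightarrow> real) \<Rightarrow> 'k list \<Rightarrow> real" where
  "wt s ks \<equiv> sum_list (map s ks)"

abbreviation freq :: "('k \<Rightarrow> complex) \<Rightarrow> 'k list \<Rightarrow> complex" where
  "freq w ks \<equiv> prod_list (map w ks)"

text \<open>In the application \<open>s\<close> is the \<eta>-norm and \<open>w k\<close> the phase
  gained per lattice step. The Diophantine bound is phrased with the weight of the word, which is
  additive under concatenation, and not with the norm of the sum of its letters, which is only
  subadditive.\<close>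

locale small_divisors =
  fixes S :: "'k set" and s :: "'k \<Rightarrow> real" and w :: "'k \<Rightarrow> complex" and B \<beta> :: real
  assumes s_ge_1: "k \<in> S \<Longrightarrow> 1 \<le> s k"
    and norm_w: "k \<in> S \<Longrightarrow> cmod (w k) = 1"
    and divisor: "\<lbrakk>ks \<in> lists S; ks \<noteq> []\<rbrakk> \<Longrightarrow> exp (- (B * wt s ks powr \<beta>)) \<le> cmod (freq w ks - 1)"
begin

lemma norm_freq: "ks \<in> lists S \<Longrightarrow> cmod (freq w ks) = 1"
  by (induction ks) (auto simp: norm_mult norm_w)

lemma wt_nonneg: "ks \<in> lists S \<Longrightarrow> 0 \<le> wt s ks"
  by (induction ks) (auto dest!: s_ge_1)

lemma wt_ge_1: "ks \<in> lists S \<Longrightarrow> ks \<noteq> [] \<Longrightarrow> 1 \<le> wt s ks"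
  by (cases ks) (auto dest!: s_ge_1 simp: add_increasing2 wt_nonneg in_listsI)

lemma freq_neq_1: "ks \<in> lists S \<Longrightarrow> ks \<noteq> [] \<Longrightarrow> freq w ks \<noteq> 1"
  using divisor[of ks] by auto

lemma freq_neq_0: "ks \<in> lists S \<Longrightarrow> freq w ks \<noteq> 0"
  using norm_freq[of ks] by auto

end

lemma neg_ln_min_le:
  fixes x y :: real
  assumes "0 \<le> y" "exp (- y) \<le> x"
  shows "- ln (min 1 x) \<le> y"
proof -
  have "exp (- y) \<le> min 1 x" using assms by simp
  then have "ln (exp (- y)) \<le> ln (min 1 x)" by (subst ln_le_cancel_iff) (auto intro: less_le_trans[of _ "exp (- y)"])
  then show ?thesis by simp
qed

text \<open>If \<open>us\<close> is the stretch between two suffixes of a word, their frequencies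
  are at distance \<open>cmod (freq w us - 1)\<close>, which the Diophantine condition bounds below;
  by the triangle inequality they cannot both be within half of that distance of \<open>a\<close>.
  So the levels \<open>- ln\<close> of the divisors are separated in the sense of
  \<open>sum_separated_bound\<close>. The position of \<open>a\<close> enters only through the worst
  single divisor, paid once as \<open>A\<close>, and therefore \<open>x0\<close> is fixed before
  \<open>a\<close> and \<open>A\<close>.\<close>

lemma suffix_divisors_bound:
  fixes B \<beta> \<kappa> :: real
  assumes B: "0 < B" and \<beta>: "0 < \<beta>" "\<beta> < 1" and \<kappa>: "0 < \<kappa>"
  obtains x0 where "0 \<le> x0"
    "\<And>S s w a A ks. \<lbrakk>small_divisors S s w B \<beta>; 0 \<le> A;
        \<And>ks. ks \<in> lists S \<Longrightarrow> ks \<noteq> [] \<Longrightarrow> exp (- (\<kappa> * wt s ks + A)) \<le> cmod (freq w ks - a);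
        ks \<in> lists (S :: 'k set)\<rbrakk>
      \<Longrightarrow> exp (- (real (length ks) * x0 + 2 * \<kappa> * wt s ks + A + 1))
           \<le> (\<Prod>i<length ks. min 1 (cmod (freq w (drop i ks) - a)))"
proof -
  have B1: "0 < B + 1" using B by simp
  show ?thesis
  proof (rule sum_separated_bound[OF B1 \<beta> \<kappa>])
    fix x0 assume x0: "0 \<le> x0"
      "\<And>n p L P F. \<lbrakk>\<And>i. i < n \<Longrightarrow> 0 \<le> p i \<and> p i \<le> P; 0 \<le> P; 0 \<le> F;
         \<And>i j. i < j \<Longrightarrow> j < n \<Longrightarrow> p j < p i \<and> min (L i) (L j) \<le> (B + 1) * (p i - p j) powr \<beta>;
         \<And>i. i < n \<Longrightarrow> L i \<le> F\<rbrakk>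
        \<Longrightarrow> (\<Sum>i<n. L i) \<le> real n * x0 + \<kappa> * P + F + (1::real)"
    show ?thesis
    proof (rule that[OF x0(1)])
      fix S :: "'k set" and s :: "'k \<Rightarrow> real" and w a A ks
      assume sd: "small_divisors S s w B \<beta>" and A: "0 \<le> A" and ks: "ks \<in> lists S"
        and fl: "\<And>ks. ks \<in> lists S \<Longrightarrow> ks \<noteq> [] \<Longrightarrow> exp (- (\<kappa> * wt s ks + A)) \<le> cmod (freq w ks - a)"
      interpret small_divisors S s w B \<beta> by fact
      define n where "n = length ks"
      define p where "p i = wt s (drop i ks)" for i
      define m where "m i = min 1 (cmod (freq w (drop i ks) - a))" for i
      have dr: "drop i ks \<in> lists S" for i using ks by (auto dest: in_set_dropD)
      have split: "\<exists>us \<in> lists S. us \<noteq> [] \<and> drop i ks = us @ drop j ks" if "i < j" "j < n" for i j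
      proof (rule bexI[of _ "take (j - i) (drop i ks)"])
        have "drop j ks = drop (j - i) (drop i ks)" using that by simp
        then have "drop i ks = take (j - i) (drop i ks) @ drop j ks"
          by (simp only: append_take_drop_id)
        then show "take (j - i) (drop i ks) \<noteq> [] \<and> drop i ks = take (j - i) (drop i ks) @ drop j ks"
          using that by (auto simp: n_def)
        show "take (j - i) (drop i ks) \<in> lists S" using dr[of i] by (auto dest: in_set_takeD)
      qed
      have p: "0 \<le> p i \<and> p i \<le> wt s ks" for i
      proof -
        have "wt s ks = wt s (take i ks) + p i"
          unfolding p_def by (metis append_take_drop_id map_append sum_list_append)
        moreover have "0 \<le> wt s (take i ks)" using ks by (intro wt_nonneg) (auto dest: in_set_takeD)
        ultimately show ?thesis using wt_nonneg[OF dr[of i]] by (simp add: p_def)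
      qed
      have mpos: "0 < m i" if "i < n" for i
        using fl[OF dr[of i]] that by (auto simp: m_def n_def intro: less_le_trans[OF exp_gt_zero])
      \<comment> \<open>One \<open>\<kappa> * wt s ks\<close> is the price of the separated levels;
        the other, together with \<open>A\<close>, is the bound \<open>F\<close> on a single
        level.\<close>
      have "(\<Sum>i<n. - ln (m i)) \<le> real n * x0 + \<kappa> * wt s ks + (\<kappa> * wt s ks + A) + 1"
      proof (rule x0(2))
        fix i j assume ij: "i < j" "j < n"
        obtain us where us: "us \<in> lists S" "us \<noteq> []" "drop i ks = us @ drop j ks"
          using split[OF ij] by auto
        have pd: "p i - p j = wt s us" by (simp add: p_def us)
        have g1: "1 \<le> p i - p j" unfolding pd by (rule wt_ge_1[OF us(1,2)])
        let ?d = "p i - p j"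
        have "exp (- (B * ?d powr \<beta>)) \<le> cmod (freq w us - 1)"
          unfolding pd by (rule divisor[OF us(1,2)])
        also have "\<dots> = cmod (freq w us - 1) * cmod (freq w (drop j ks))"
          by (simp add: norm_freq[OF dr])
        also have "\<dots> = cmod ((freq w (drop i ks) - a) - (freq w (drop j ks) - a))"
          by (simp add: us flip: norm_mult) (simp add: algebra_simps)
        also have "\<dots> \<le> cmod (freq w (drop i ks) - a) + cmod (freq w (drop j ks) - a)"
          by (rule norm_triangle_ineq4)
        finally have sum: "exp (- (B * ?d powr \<beta>)) \<le> cmod (freq w (drop i ks) - a) + cmod (freq w (drop j ks) - a)" .
        \<comment> \<open>The extra unit in \<open>B + 1\<close> pays for the factor 1/2 lost in the
          triangle inequality.\<close>
        have "1 \<le> ?d powr \<beta>" using g1 \<beta> by (simp add: ge_one_powr_ge_zero)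
        moreover have "exp (-1) \<le> (1/2::real)"
          using exp_ge_add_one_self[of 1] by (simp add: exp_minus field_simps)
        ultimately have "exp (- ((B + 1) * ?d powr \<beta>)) \<le> exp (- (B * ?d powr \<beta>)) * (1/2)"
          by (simp add: algebra_simps exp_diff exp_minus field_simps)
            (smt (verit, best) exp_ge_add_one_self exp_gt_zero mult_left_mono)
        then have "exp (- ((B + 1) * ?d powr \<beta>)) \<le> cmod (freq w (drop i ks) - a)
            \<or> exp (- ((B + 1) * ?d powr \<beta>)) \<le> cmod (freq w (drop j ks) - a)"
          using sum by linarith
        then have "- ln (m i) \<le> (B + 1) * ?d powr \<beta> \<or> - ln (m j) \<le> (B + 1) * ?d powr \<beta>"
          unfolding m_def using B by (intro disj_forward[OF _ neg_ln_min_le neg_ln_min_le]) auto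
        then show "p j < p i \<and> min (- ln (m i)) (- ln (m j)) \<le> (B + 1) * ?d powr \<beta>"
          using g1 by auto
      next
        fix i assume i: "i < n"
        have "exp (- (\<kappa> * wt s ks + A)) \<le> exp (- (\<kappa> * p i + A))"
          using p[of i] \<kappa> by simp
        also have "\<dots> \<le> cmod (freq w (drop i ks) - a)"
          unfolding p_def using i by (intro fl[OF dr]) (simp add: n_def)
        finally show "- ln (m i) \<le> \<kappa> * wt s ks + A"
          unfolding m_def using wt_nonneg[OF ks] \<kappa> A by (intro neg_ln_min_le) auto
      qed (use p wt_nonneg[OF ks] \<kappa> A in auto)
      moreover have "(\<Prod>i<n. m i) = exp (- (\<Sum>i<n. - ln (m i)))"
        using mpos by (simp add: sum_negf exp_sum)
      ultimately show "exp (- (real (length ks) * x0 + 2 * \<kappa> * wt s ks + A + 1))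
             \<le> (\<Prod>i<length ks. min 1 (cmod (freq w (drop i ks) - a)))"
        by (simp add: m_def n_def)
    qed
  qed
qed

subsection \<open>Perturbed plane waves\<close>

lemma abs_summable_times:
  fixes f :: "'a \<Rightarrow> 'c :: {real_normed_field, banach}" and g :: "'b \<Rightarrow> 'c"
  assumes "f abs_summable_on A" "g abs_summable_on B"
  shows "(\<lambda>(x, y). f x * g y) abs_summable_on A \<times> B"
  unfolding Infinite_Sum.abs_summable_on_Sigma_iff using assms
  by (auto simp: norm_mult infsum_cmult_right' infsum_nonneg abs_mult intro!: summable_on_cmult_right summable_on_cmult_left)

lemma infsum_times:
  fixes f :: "'a \<Rightarrow> 'c :: {real_normed_field, banach}" and g :: "'b \<Rightarrow> 'c"
  assumes "f abs_summable_on A" "g abs_summable_on B"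
  shows "(\<Sum>\<^sub>\<infinity>x\<in>A. f x) * (\<Sum>\<^sub>\<infinity>y\<in>B. g y) = (\<Sum>\<^sub>\<infinity>(x, y)\<in>A \<times> B. f x * g y)"
proof -
  have "(\<Sum>\<^sub>\<infinity>(x, y)\<in>A \<times> B. f x * g y) = (\<Sum>\<^sub>\<infinity>x\<in>A. \<Sum>\<^sub>\<infinity>y\<in>B. f x * g y)"
    by (rule infsum_Sigma'_banach[symmetric], rule abs_summable_summable)
       (rule abs_summable_times[OF assms])
  then show ?thesis by (simp add: infsum_cmult_right' infsum_cmult_left')
qed

lemma sum_prod_list_lists_length:
  fixes f :: "'k \<Rightarrow> 'a :: comm_semiring_1"
  assumes "finite A"
  shows "(\<Sum>ks | set ks \<subseteq> A \<and> length ks = n. prod_list (map f ks)) = (\<Sum>k\<in>A. f k) ^ n"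
proof (induction n)
  case 0
  have "{ks. set ks \<subseteq> A \<and> length ks = 0} = {[]}" by auto
  then show ?case by simp
next
  case (Suc n)
  have eq: "{ks. set ks \<subseteq> A \<and> length ks = Suc n} =
      (\<lambda>(k, ks). k # ks) ` (A \<times> {ks. set ks \<subseteq> A \<and> length ks = n})"
    by (auto simp: length_Suc_conv image_iff)
  have inj: "inj_on (\<lambda>(k, ks). k # ks) X" for X :: "('k \<times> 'k list) set"
    by (auto simp: inj_on_def)
  show ?case
    unfolding eq sum.reindex[OF inj]
    by (simp add: Suc[symmetric] sum_product sum.cartesian_product split_def comp_def)
qed

text \<open>Words of length \<open>n\<close> over a finite alphabet contribute the
  \<open>n\<close>-th power of the sum over the alphabet, so a geometric series bounds all partial
  sums. Every finite set of words has a finite alphabet and bounded length, hence no infinite sums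
  have to be interchanged.\<close>

lemma summable_on_prod_list:
  fixes f :: "'k \<Rightarrow> real"
  assumes nn: "\<And>k. k \<in> S \<Longrightarrow> 0 \<le> f k" and sm: "f summable_on S" and lt: "infsum f S < 1"
  shows "(\<lambda>ks. prod_list (map f ks)) summable_on lists S"
proof (rule nonneg_bdd_above_summable_on)
  define q where "q = infsum f S"
  have q: "0 \<le> q" "q < 1" using lt nn by (auto simp: q_def intro: infsum_nonneg)
  have nnp: "0 \<le> prod_list (map f ks)" if "ks \<in> lists S" for ks
    using that by (induction ks) (auto simp: nn)
  then show "0 \<le> prod_list (map f ks)" if "ks \<in> lists S" for ks using that .
  show "bdd_above (sum (\<lambda>ks. prod_list (map f ks)) ` {F. F \<subseteq> lists S \<and> finite F})"
  proof (rule bdd_aboveI2)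
    fix F assume F: "F \<in> {F. F \<subseteq> lists S \<and> finite F}"
    define A where "A = (\<Union>ks\<in>F. set ks)"
    define N where "N = Suc (Max (length ` F))"
    have A: "finite A" "A \<subseteq> S" using F by (auto simp: A_def)
    have sumA: "0 \<le> (\<Sum>k\<in>A. f k)" "(\<Sum>k\<in>A. f k) \<le> q"
      using A nn sm by (auto simp: q_def intro!: sum_nonneg finite_sum_le_infsum)
    define L where "L n = {ks. set ks \<subseteq> A \<and> length ks = n}" for n
    have finL: "finite (L n)" for n using A finite_lists_length_eq by (auto simp: L_def)
    have sub: "F \<subseteq> (\<Union>n<N. L n)"
      using F by (auto simp: A_def L_def N_def less_Suc_eq_le)
    have "(\<Sum>ks\<in>F. prod_list (map f ks)) \<le> (\<Sum>ks\<in>(\<Union>n<N. L n). prod_list (map f ks))"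
      using sub finL A by (intro sum_mono2 nnp) (auto simp: L_def)
    also have "\<dots> = (\<Sum>n<N. \<Sum>ks\<in>L n. prod_list (map f ks))"
      using finL by (intro sum.UNION_disjoint) (auto simp: L_def)
    also have "\<dots> = (\<Sum>n<N. (\<Sum>k\<in>A. f k) ^ n)"
      unfolding L_def using sum_prod_list_lists_length[OF A(1)] by (intro sum.cong) auto
    also have "\<dots> \<le> (\<Sum>n<N. q ^ n)" using sumA by (intro sum_mono power_mono) auto
    also have "\<dots> \<le> (\<Sum>n. q ^ n)"
      using q by (intro sum_le_suminf summable_geometric) auto
    finally show "(\<Sum>ks\<in>F. prod_list (map f ks)) \<le> (\<Sum>n. q ^ n)" .
  qed
qed

text \<open>Perturbation series of a wave with leading term \<open>t powi n\<close>, indexed by the words \<open>ks\<close> of exponents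
  rather than by their sum. The frequencies produced on the way are those of the suffixes of \<open>ks\<close>; since
  all exponents lie in a cone, no nonempty word has frequency 1. \<open>D\<close> is the symbol of the free operator
  minus the energy.\<close>

fun wcoef :: "('k \<Rightarrow> complex) \<Rightarrow> ('k \<Rightarrow> complex) \<Rightarrow> (complex \<Rightarrow> complex) \<Rightarrow> 'k list \<Rightarrow> complex" where
  "wcoef g w D [] = 1"
| "wcoef g w D (k # ks) = - (g k * wcoef g w D ks / D (freq w (k # ks)))"

definition wave ::
  "'k set \<Rightarrow> ('k \<Rightarrow> complex) \<Rightarrow> ('k \<Rightarrow> complex) \<Rightarrow> (complex \<Rightarrow> complex) \<Rightarrow> complex \<Rightarrow> int \<Rightarrow> complex" where
  "wave S g w D t n = (\<Sum>\<^sub>\<infinity>ks\<in>lists S. wcoef g w D ks * (t * freq w ks) powi n)"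

lemma lists_eq_insert_Cons: "lists S = insert [] ((\<lambda>(k, ks). k # ks) ` (S \<times> lists S))"
proof (intro set_eqI iffI)
  fix ks assume "ks \<in> lists S"
  then show "ks \<in> insert [] ((\<lambda>(k, ks). k # ks) ` (S \<times> lists S))"
    by cases auto
qed auto

context small_divisors
begin

lemma abs_summable_wave:
  assumes "wcoef g w D abs_summable_on lists S"
  shows "(\<lambda>ks. wcoef g w D ks * (t * freq w ks) powi n) abs_summable_on lists S"
proof -
  have "(\<lambda>ks. cmod (wcoef g w D ks) * cmod t powi n) summable_on lists S"
    by (intro summable_on_cmult_left assms)
  also have "?this \<longleftrightarrow> ?thesis"
    by (intro summable_on_cong) (auto simp: norm_mult norm_power_int norm_freq)
  finally show ?thesis .
qed

lemma norm_wave_le: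
  assumes "wcoef g w D abs_summable_on lists S"
  shows "cmod (wave S g w D t n) \<le> (\<Sum>\<^sub>\<infinity>ks\<in>lists S. cmod (wcoef g w D ks)) * cmod t powi n"
proof -
  have "cmod (wave S g w D t n) \<le> (\<Sum>\<^sub>\<infinity>ks\<in>lists S. cmod (wcoef g w D ks * (t * freq w ks) powi n))"
    unfolding wave_def by (rule norm_infsum_bound[OF abs_summable_wave[OF assms]])
  also have "\<dots> = (\<Sum>\<^sub>\<infinity>ks\<in>lists S. cmod (wcoef g w D ks) * cmod t powi n)"
    by (intro infsum_cong) (auto simp: norm_mult norm_power_int norm_freq)
  finally show ?thesis by (simp add: infsum_cmult_left')
qed

text \<open>The free operator minus \<open>E\<close> multiplies the term of a word by
  \<open>D\<close> at its frequency. For a word \<open>k # ks\<close> this cancels the division in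
  \<open>wcoef\<close> and leaves minus the term of \<open>ks\<close> times the mode
  \<open>k\<close> of the potential; summed over all \<open>k\<close> and \<open>ks\<close> these
  are minus the potential times the wave. Only the empty word is left over.\<close>

lemma wave_equation:
  assumes ws: "wcoef g w D abs_summable_on lists S" and gs: "g abs_summable_on S"
    and D: "\<And>y. D y = t * y + inverse (t * y) - E" and t: "t \<noteq> 0"
    and D0: "\<And>ks. ks \<in> lists S \<Longrightarrow> ks \<noteq> [] \<Longrightarrow> D (freq w ks) \<noteq> 0"
  shows "wave S g w D t (n + 1) + wave S g w D t (n - 1) +
      (\<Sum>\<^sub>\<infinity>k\<in>S. g k * w k powi n) * wave S g w D t n - E * wave S g w D t n = D 1 * t powi n"
proof -
  define a where "a n ks = wcoef g w D ks * (t * freq w ks) powi n" for n ks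
  have asm: "a n summable_on lists S" for n
    unfolding a_def by (rule abs_summable_summable[OF abs_summable_wave[OF ws]])
  have nz: "t * freq w ks \<noteq> 0" if "ks \<in> lists S" for ks using that t freq_neq_0 by auto
  have pt: "a (n + 1) ks + a (n - 1) ks - E * a n ks = D (freq w ks) * a n ks" if "ks \<in> lists S" for ks
    using nz[OF that] by (simp add: a_def D power_int_add power_int_diff divide_inverse algebra_simps)
  have "((\<lambda>ks. a (n + 1) ks + a (n - 1) ks + (- E) * a n ks) has_sum
      (wave S g w D t (n + 1) + wave S g w D t (n - 1) + (- E) * wave S g w D t n)) (lists S)"
    unfolding wave_def a_def[symmetric]
    by (intro has_sum_add has_sum_cmult_right has_sum_infsum asm)
  also have "?this \<longleftrightarrow> ((\<lambda>ks. D (freq w ks) * a n ks) has_sum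
      (wave S g w D t (n + 1) + wave S g w D t (n - 1) + (- E) * wave S g w D t n)) (lists S)"
    using pt by (intro has_sum_cong) auto
  finally have hs: "((\<lambda>ks. D (freq w ks) * a n ks) has_sum
      (wave S g w D t (n + 1) + wave S g w D t (n - 1) - E * wave S g w D t n)) (lists S)"
    by simp
  note lhs = infsumI[OF hs, symmetric] and sumD = has_sum_imp_summable[OF hs]
  have inj: "inj_on (\<lambda>(k, ks). k # ks) X" for X :: "('k \<times> 'k list) set"
    by (auto simp: inj_on_def)
  define C where "C = (\<lambda>(k, ks). k # ks) ` (S \<times> lists S)"
  have LC: "lists S = insert [] C" "[] \<notin> C" unfolding C_def by (rule lists_eq_insert_Cons) auto
  have "(\<Sum>\<^sub>\<infinity>ks\<in>lists S. D (freq w ks) * a n ks) = D 1 * t powi n + (\<Sum>\<^sub>\<infinity>ks\<in>C. D (freq w ks) * a n ks)"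
  proof -
    have "(\<lambda>ks. D (freq w ks) * a n ks) summable_on C"
      by (rule summable_on_subset_banach[OF sumD]) (use LC in blast)
    from infsum_insert[OF this LC(2)] show ?thesis
      unfolding LC(1) by (simp add: a_def)
  qed
  also have "(\<Sum>\<^sub>\<infinity>ks\<in>C. D (freq w ks) * a n ks)
      = (\<Sum>\<^sub>\<infinity>(k, ks)\<in>S \<times> lists S. - (g k * w k powi n * a n ks))"
    unfolding C_def infsum_reindex[OF inj]
  proof (rule infsum_cong)
    fix x assume "x \<in> S \<times> lists S"
    then obtain k ks where x: "x = (k, ks)" "k \<in> S" "ks \<in> lists S" by auto
    have "D (freq w (k # ks)) \<noteq> 0" by (rule D0) (use x in auto)
    then show "((\<lambda>ks. D (freq w ks) * a n ks) \<circ> (\<lambda>(k, ks). k # ks)) x =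
         (case x of (k, ks) \<Rightarrow> - (g k * w k powi n * a n ks))"
      by (simp add: x a_def power_int_mult_distrib)
  qed
  also have "\<dots> = - (\<Sum>\<^sub>\<infinity>(k, ks)\<in>S \<times> lists S. g k * w k powi n * a n ks)"
    by (simp add: split_def flip: infsum_uminus)
  also have "(\<Sum>\<^sub>\<infinity>(k, ks)\<in>S \<times> lists S. g k * w k powi n * a n ks)
      = (\<Sum>\<^sub>\<infinity>k\<in>S. g k * w k powi n) * (\<Sum>\<^sub>\<infinity>ks\<in>lists S. a n ks)"
  proof (rule infsum_times[symmetric])
    have "(\<lambda>k. cmod (g k * w k powi n)) summable_on S \<longleftrightarrow> (\<lambda>k. cmod (g k)) summable_on S"
      by (intro summable_on_cong) (auto simp: norm_mult norm_power_int norm_w)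
    then show "(\<lambda>k. g k * w k powi n) abs_summable_on S" using gs by simp
    show "a n abs_summable_on lists S" unfolding a_def by (rule abs_summable_wave[OF ws])
  qed
  finally show ?thesis using lhs by (simp add: wave_def a_def algebra_simps)
qed

text \<open>Unrolling \<open>wcoef\<close> gives one division per nonempty suffix, and
  \<open>D\<close> splits each into two distances at the cost of a factor 2 per letter. The
  distances are kept on the left so that lower bounds for their products can be inserted
  afterwards.\<close>

lemma wcoef_mult_divisors_le:
  fixes a b :: complex
  assumes D: "\<And>ks. ks \<in> lists S \<Longrightarrow> ks \<noteq> [] \<Longrightarrow>
      min 1 (cmod (freq w ks - a)) * min 1 (cmod (freq w ks - b)) \<le> 2 * cmod (D (freq w ks))"
    and D0: "\<And>ks. ks \<in> lists S \<Longrightarrow> ks \<noteq> [] \<Longrightarrow> D (freq w ks) \<noteq> 0"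
    and ks: "ks \<in> lists S"
  shows "cmod (wcoef g w D ks) * ((\<Prod>i<length ks. min 1 (cmod (freq w (drop i ks) - a))) *
      (\<Prod>i<length ks. min 1 (cmod (freq w (drop i ks) - b)))) \<le> prod_list (map (\<lambda>k. 2 * cmod (g k)) ks)"
  using ks
proof (induction ks)
  case Nil
  then show ?case by simp
next
  case (Cons k ks)
  define y where "y = freq w (k # ks)"
  define m where "m a = min 1 (cmod (y - a))" for a
  define P where "P a = (\<Prod>i<length ks. min 1 (cmod (freq w (drop i ks) - a)))" for a
  have kks: "k # ks \<in> lists S" using Cons.hyps by simp
  have y: "D y \<noteq> 0" "m a * m b \<le> 2 * cmod (D y)"
    unfolding y_def m_def using D[OF kks] D0[OF kks] by auto
  have P: "P a \<ge> 0" for a unfolding P_def by (intro prod_nonneg) auto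
  have split: "(\<Prod>i<length (k # ks). min 1 (cmod (freq w (drop i (k # ks)) - a))) = m a * P a" for a
    by (simp add: m_def P_def y_def prod.lessThan_Suc_shift del: prod.lessThan_Suc)
  have "cmod (wcoef g w D (k # ks)) * (m a * P a * (m b * P b))
      = cmod (g k) * ((m a * m b) / cmod (D y)) * (cmod (wcoef g w D ks) * (P a * P b))"
    by (simp add: y_def norm_mult norm_divide)
  also have "\<dots> \<le> cmod (g k) * 2 * prod_list (map (\<lambda>k. 2 * cmod (g k)) ks)"
    using Cons.IH Cons.hyps y P
    by (intro mult_mono) (auto simp: P_def m_def divide_le_eq intro!: mult_nonneg_nonneg divide_nonneg_nonneg)
  finally show ?case unfolding split by simp
qed

end

section \<open>Means of exponential sums\<close>

lemma mean_of_powers_tendsto_0: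
  fixes \<rho> :: complex
  assumes "cmod \<rho> = 1" "\<rho> \<noteq> 1"
  shows "(\<lambda>m. (\<Sum>n<m. \<rho> ^ n) / of_nat m) \<longlonglongrightarrow> 0"
proof (rule Lim_null_comparison)
  show "\<forall>\<^sub>F m in sequentially. cmod ((\<Sum>n<m. \<rho> ^ n) / of_nat m) \<le> (2 / cmod (1 - \<rho>)) * inverse (real m)"
  proof (intro always_eventually allI)
    fix m
    have "cmod (\<Sum>n<m. \<rho> ^ n) = cmod (1 - \<rho> ^ m) / cmod (1 - \<rho>)"
      using assms by (simp add: sum_gp_strict norm_divide)
    also have "cmod (1 - \<rho> ^ m) \<le> 1 + cmod (\<rho> ^ m)"
      using norm_triangle_ineq4[of 1 "\<rho> ^ m"] by simp
    also have "\<dots> = 2" using assms by (simp add: norm_power)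
    finally have "cmod (\<Sum>n<m. \<rho> ^ n) \<le> 2 / cmod (1 - \<rho>)"
      by (simp add: divide_right_mono)
    then show "cmod ((\<Sum>n<m. \<rho> ^ n) / of_nat m) \<le> (2 / cmod (1 - \<rho>)) * inverse (real m)"
      using mult_right_mono[of _ _ "inverse (real m)"] by (simp add: norm_mult norm_inverse divide_inverse)
  qed
  show "(\<lambda>m. (2 / cmod (1 - \<rho>)) * inverse (real m)) \<longlonglongrightarrow> 0"
    using tendsto_mult_left[OF lim_inverse_n, of "2 / cmod (1 - \<rho>)"] by simp
qed

lemma has_sum_sum:
  fixes f :: "'j \<Rightarrow> 'i \<Rightarrow> 'a :: topological_comm_monoid_add"
  assumes "\<And>j. j \<in> J \<Longrightarrow> (f j has_sum s j) A"
  shows "((\<lambda>i. \<Sum>j\<in>J. f j i) has_sum (\<Sum>j\<in>J. s j)) A"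
  using assms
proof (induction J rule: infinite_finite_induct)
  case (insert x F)
  then show ?case by (simp add: has_sum_add)
qed simp_all

text \<open>The means of each mode are bounded by 1, so up to a small tail of \<open>a\<close> only
  finitely many modes count, and each of these except \<open>i0\<close> averages to 0. The values
  \<open>\<rho> i\<close> may coincide for different \<open>i\<close>, as happens for families
  indexed by words.\<close>

lemma mean_of_exponential_sum_tendsto:
  fixes a \<rho> :: "'i \<Rightarrow> complex"
  assumes a: "a abs_summable_on I" and \<rho>: "\<And>i. i \<in> I \<Longrightarrow> cmod (\<rho> i) = 1"
    and i0: "i0 \<in> I" "\<rho> i0 = 1" and other: "\<And>i. i \<in> I \<Longrightarrow> i \<noteq> i0 \<Longrightarrow> \<rho> i \<noteq> 1"
  shows "(\<lambda>m. (\<Sum>n<m. \<Sum>\<^sub>\<infinity>i\<in>I. a i * \<rho> i ^ n) / of_nat m) \<longlonglongrightarrow> a i0"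
proof (rule LIMSEQ_I)
  fix e :: real assume e: "0 < e"
  obtain F0 where F0: "finite F0" "F0 \<subseteq> I"
    "dist (sum (\<lambda>i. cmod (a i)) F0) (\<Sum>\<^sub>\<infinity>i\<in>I. cmod (a i)) \<le> e / 2"
    using infsum_finite_approximation[OF a, of "e / 2"] e by auto
  define F where "F = insert i0 F0"
  have F: "finite F" "F \<subseteq> I" "i0 \<in> F" using F0 i0 by (auto simp: F_def)
  have IF: "(I - F) \<inter> F = {}" "I - F \<union> F = I" using F by auto
  have aIF: "a abs_summable_on (I - F)"
    by (rule summable_on_subset_banach[OF a]) auto
  have tail: "(\<Sum>\<^sub>\<infinity>i\<in>I - F. cmod (a i)) \<le> e / 2"
  proof -
    have "(\<Sum>\<^sub>\<infinity>i\<in>I. cmod (a i)) = (\<Sum>\<^sub>\<infinity>i\<in>I - F. cmod (a i)) + sum (\<lambda>i. cmod (a i)) F"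
      using infsum_Un_disjoint[OF aIF summable_on_finite[OF F(1)] IF(1)] F(1)
      unfolding IF(2) by simp
    moreover have "sum (\<lambda>i. cmod (a i)) F0 \<le> sum (\<lambda>i. cmod (a i)) F"
      using F by (intro sum_mono2) (auto simp: F_def)
    ultimately show ?thesis using F0(3) unfolding dist_real_def by linarith
  qed
  define b where "b i m = (\<Sum>n<m. \<rho> i ^ n) / of_nat m" for i m
  have b1: "cmod (b i m) \<le> 1" if "i \<in> I" for i m
  proof -
    have "cmod (\<Sum>n<m. \<rho> i ^ n) \<le> (\<Sum>n<m. 1)"
      by (rule order_trans[OF norm_sum sum_mono]) (simp add: norm_power \<rho>[OF that])
    then show ?thesis by (cases "m = 0") (auto simp: b_def norm_divide divide_le_eq_1)
  qed
  have aS: "(\<lambda>i. a i * \<rho> i ^ n) abs_summable_on I" for n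
    using a by (rule Infinite_Sum.abs_summable_on_comparison_test) (simp add: norm_mult norm_power \<rho>)
  have aS': "(\<lambda>i. a i * \<rho> i ^ n) summable_on I" for n
    by (rule abs_summable_summable[OF aS])
  have mean: "((\<lambda>i. a i * b i m) has_sum ((\<Sum>n<m. \<Sum>\<^sub>\<infinity>i\<in>I. a i * \<rho> i ^ n) / of_nat m)) I" for m
  proof -
    have "((\<lambda>i. \<Sum>n<m. a i * \<rho> i ^ n) has_sum (\<Sum>n<m. \<Sum>\<^sub>\<infinity>i\<in>I. a i * \<rho> i ^ n)) I"
      by (rule has_sum_sum) (rule has_sum_infsum[OF aS'])
    then have "((\<lambda>i. (\<Sum>n<m. a i * \<rho> i ^ n) * inverse (of_nat m)) has_sum
        ((\<Sum>n<m. \<Sum>\<^sub>\<infinity>i\<in>I. a i * \<rho> i ^ n) * inverse (of_nat m))) I"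
      by (rule has_sum_cmult_left)
    also have "(\<lambda>i. (\<Sum>n<m. a i * \<rho> i ^ n) * inverse (of_nat m)) = (\<lambda>i. a i * b i m)"
      by (simp add: b_def divide_inverse sum_distrib_left[symmetric] mult.assoc)
    finally show ?thesis by (simp add: divide_inverse)
  qed
  have "(\<lambda>m. \<Sum>i\<in>F. a i * b i m) \<longlonglongrightarrow> (\<Sum>i\<in>F. a i * of_bool (i = i0))"
  proof (intro tendsto_sum tendsto_mult tendsto_const)
    fix i assume i: "i \<in> F"
    show "(\<lambda>m. b i m) \<longlonglongrightarrow> of_bool (i = i0)"
    proof (cases "i = i0")
      case True
      have "eventually (\<lambda>m. b i m = 1) sequentially"
        using eventually_gt_at_top[of 0] by eventually_elim (simp add: b_def True i0)
      then show ?thesis using True by (simp add: tendsto_eventually)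
    next
      case False
      then show ?thesis unfolding b_def
        using mean_of_powers_tendsto_0[of "\<rho> i"] \<rho> other i F by auto
    qed
  qed
  also have "(\<Sum>i\<in>F. a i * of_bool (i = i0)) = a i0"
  proof -
    have "(\<Sum>i\<in>F. a i * of_bool (i = i0)) = (\<Sum>i\<in>F. if i = i0 then a i else 0)"
      by (intro sum.cong) auto
    then show ?thesis using F by simp
  qed
  finally have lim: "(\<lambda>m. \<Sum>i\<in>F. a i * b i m) \<longlonglongrightarrow> a i0" .
  obtain m0 where m0: "\<And>m. m \<ge> m0 \<Longrightarrow> norm ((\<Sum>i\<in>F. a i * b i m) - a i0) < e / 2"
    using LIMSEQ_D[OF lim, of "e / 2"] e by auto
  show "\<exists>no. \<forall>m\<ge>no. norm ((\<Sum>n<m. \<Sum>\<^sub>\<infinity>i\<in>I. a i * \<rho> i ^ n) / of_nat m - a i0) < e"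
  proof (intro exI allI impI)
    fix m assume m: "m0 \<le> m"
    have ab: "(\<lambda>i. a i * b i m) abs_summable_on (I - F)"
      using aIF by (rule Infinite_Sum.abs_summable_on_comparison_test)
        (use b1 in \<open>auto simp: norm_mult intro!: mult_left_le\<close>)
    have "(\<Sum>n<m. \<Sum>\<^sub>\<infinity>i\<in>I. a i * \<rho> i ^ n) / of_nat m = (\<Sum>\<^sub>\<infinity>i\<in>I. a i * b i m)"
      by (rule infsumI[OF mean, symmetric])
    also have "\<dots> = (\<Sum>\<^sub>\<infinity>i\<in>I - F. a i * b i m) + (\<Sum>i\<in>F. a i * b i m)"
      using infsum_Un_disjoint[OF abs_summable_summable[OF ab] summable_on_finite[OF F(1)] IF(1)] F(1)
      unfolding IF(2) by simp
    finally have eq: "(\<Sum>n<m. \<Sum>\<^sub>\<infinity>i\<in>I. a i * \<rho> i ^ n) / of_nat m - a i0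
        = (\<Sum>\<^sub>\<infinity>i\<in>I - F. a i * b i m) + ((\<Sum>i\<in>F. a i * b i m) - a i0)"
      by simp
    have "norm ((\<Sum>n<m. \<Sum>\<^sub>\<infinity>i\<in>I. a i * \<rho> i ^ n) / of_nat m - a i0)
        \<le> norm (\<Sum>\<^sub>\<infinity>i\<in>I - F. a i * b i m) + norm ((\<Sum>i\<in>F. a i * b i m) - a i0)"
      unfolding eq by (rule norm_triangle_ineq)
    also have "norm (\<Sum>\<^sub>\<infinity>i\<in>I - F. a i * b i m) \<le> (\<Sum>\<^sub>\<infinity>i\<in>I - F. cmod (a i))"
      by (rule norm_infsum_le[OF has_sum_infsum[OF abs_summable_summable[OF ab]] has_sum_infsum[OF aIF]])
        (use b1 in \<open>auto simp: norm_mult intro!: mult_left_le\<close>)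
    finally show "norm ((\<Sum>n<m. \<Sum>\<^sub>\<infinity>i\<in>I. a i * \<rho> i ^ n) / of_nat m - a i0) < e"
      using tail m0[OF m] by linarith
  qed
qed

text \<open>A floor for single divisors with prescribed slope and free offset. The slope has to fit
  into the analyticity width; the offset may depend on \<open>a\<close>, and for points off the
  circle it grows as they approach it.\<close>

definition (in small_divisors) apart :: "real \<Rightarrow> complex \<Rightarrow> bool" where
  "apart \<kappa> a \<longleftrightarrow> (\<exists>A\<ge>0. \<forall>ks\<in>lists S. ks \<noteq> [] \<longrightarrow> exp (- (\<kappa> * wt s ks + A)) \<le> cmod (freq w ks - a))"

context small_divisors
begin

lemma apart_1:
  assumes "0 < B" "0 < \<beta>" "\<beta> < 1" "0 < \<kappa>"
  shows "apart \<kappa> 1"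
proof -
  obtain A where A: "0 \<le> A" "\<And>x. 0 \<le> x \<Longrightarrow> B * x powr \<beta> \<le> \<kappa> * x + A"
    using powr_le_linear[of B \<beta> \<kappa>] assms by auto
  show ?thesis unfolding apart_def
  proof (intro exI[of _ A] conjI A ballI impI)
    fix ks assume ks: "ks \<in> lists S" "ks \<noteq> []"
    have "exp (- (\<kappa> * wt s ks + A)) \<le> exp (- (B * wt s ks powr \<beta>))"
      using A(2)[OF wt_nonneg[OF ks(1)]] by simp
    also have "\<dots> \<le> cmod (freq w ks - 1)" by (rule divisor[OF ks])
    finally show "exp (- (\<kappa> * wt s ks + A)) \<le> cmod (freq w ks - 1)" .
  qed
qed

lemma apart_off_circle:
  assumes "cmod a \<noteq> 1" "0 < \<kappa>"
  shows "apart \<kappa> a"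
proof -
  define c where "c = \<bar>1 - cmod a\<bar>"
  have c: "c > 0" using assms by (simp add: c_def)
  show ?thesis unfolding apart_def
  proof (intro exI[of _ "max 0 (- ln c)"] conjI ballI impI)
    fix ks assume ks: "ks \<in> lists S" "ks \<noteq> []"
    have "0 \<le> \<kappa> * wt s ks" using wt_nonneg[OF ks(1)] assms by simp
    then have "exp (- (\<kappa> * wt s ks + max 0 (- ln c))) \<le> exp (ln c)" by simp
    also have "\<dots> = \<bar>cmod (freq w ks) - cmod a\<bar>" using c by (simp add: c_def norm_freq ks)
    also have "\<dots> \<le> cmod (freq w ks - a)" by (rule norm_triangle_ineq3)
    finally show "exp (- (\<kappa> * wt s ks + max 0 (- ln c))) \<le> cmod (freq w ks - a)" .
  qed simp
qed

lemma apart_neq: "apart \<kappa> a \<Longrightarrow> ks \<in> lists S \<Longrightarrow> ks \<noteq> [] \<Longrightarrow> freq w ks \<noteq> a"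
proof
  assume "apart \<kappa> a" and ks: "ks \<in> lists S" "ks \<noteq> []" and eq: "freq w ks = a"
  from \<open>apart \<kappa> a\<close> obtain A
    where "\<forall>ks\<in>lists S. ks \<noteq> [] \<longrightarrow> exp (- (\<kappa> * wt s ks + A)) \<le> cmod (freq w ks - a)"
    unfolding apart_def by (elim exE conjE)
  then have "exp (- (\<kappa> * wt s ks + A)) \<le> cmod (freq w ks - a)"
    using ks by simp
  moreover have "0 < exp (- (\<kappa> * wt s ks + A))" by (rule exp_gt_zero)
  ultimately show False by (simp add: eq)
qed

end

text \<open>Per letter the series loses a factor \<open>c\<close> and the weight
  \<open>exp (h * s k)\<close>, both independent of \<open>a\<close> and \<open>b\<close>; their
  offsets come out as the prefactor \<open>exp (A + A' + 2)\<close>. So \<open>l0\<close> can be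
  chosen before \<open>S\<close>, \<open>w\<close>, \<open>f\<close> and the two points, which makes
  it uniform in the energy and in the cone weights.\<close>

lemma abs_summable_wcoef:
  fixes B \<beta> h N :: real
  assumes B: "0 < B" and \<beta>: "0 < \<beta>" "\<beta> < 1" and h: "0 < h"
  obtains l0 where "0 < l0"
    "\<And>S s w f l a b D. \<lbrakk>small_divisors (S :: 'k set) s w B \<beta>;
        (\<lambda>k. cmod (f k) * exp (h * s k)) summable_on S; (\<Sum>\<^sub>\<infinity>k\<in>S. cmod (f k) * exp (h * s k)) \<le> N;
        \<bar>l\<bar> < l0; small_divisors.apart S s w (h / 4) a; small_divisors.apart S s w (h / 4) b;
        \<And>y. cmod y = 1 \<Longrightarrow> min 1 (cmod (y - a)) * min 1 (cmod (y - b)) \<le> 2 * cmod (D y)\<rbrakk>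
      \<Longrightarrow> wcoef (\<lambda>k. complex_of_real l * f k) w D abs_summable_on lists S"
proof -
  \<comment> \<open>Each of the two points \<open>a\<close>, \<open>b\<close> costs twice its slope,
    so a quarter of the width for each slope uses up \<open>h\<close> exactly.\<close>
  have h4: "0 < h / 4" using h by simp
  show ?thesis
  proof (rule suffix_divisors_bound[OF B \<beta> h4])
    fix x0 assume x0: "0 \<le> x0"
      "\<And>S s w a A ks. \<lbrakk>small_divisors S s w B \<beta>; 0 \<le> A;
          \<And>ks. ks \<in> lists S \<Longrightarrow> ks \<noteq> [] \<Longrightarrow> exp (- (h / 4 * wt s ks + A)) \<le> cmod (freq w ks - a);
          ks \<in> lists (S :: 'k set)\<rbrakk>
        \<Longrightarrow> exp (- (real (length ks) * x0 + 2 * (h / 4) * wt s ks + A + 1))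
             \<le> (\<Prod>i<length ks. min 1 (cmod (freq w (drop i ks) - a)))"
    \<comment> \<open>Per letter: the 2 is the loss in the bound on \<open>D\<close>, and each of
      the two points costs \<open>exp x0\<close>.\<close>
    define c where "c = 2 * exp (2 * x0)"
    have c: "c > 0" by (simp add: c_def)
    \<comment> \<open>\<open>N\<close> is an arbitrary real here, and
      \<open>\<bar>N\<bar> + 1\<close> keeps the denominator positive.\<close>
    define l0 where "l0 = 1 / (c * (\<bar>N\<bar> + 1))"
    show ?thesis
    proof (rule that[of l0])
      show "0 < l0" using c by (simp add: l0_def)
      fix S :: "'k set" and s :: "'k \<Rightarrow> real" and w f :: "'k \<Rightarrow> complex" and l a b D
      assume sd: "small_divisors S s w B \<beta>"
        and fs: "(\<lambda>k. cmod (f k) * exp (h * s k)) summable_on S"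
        and fN: "(\<Sum>\<^sub>\<infinity>k\<in>S. cmod (f k) * exp (h * s k)) \<le> N" and l: "\<bar>l\<bar> < l0"
        and ap: "small_divisors.apart S s w (h / 4) a" "small_divisors.apart S s w (h / 4) b"
        and D: "\<And>y. cmod y = 1 \<Longrightarrow> min 1 (cmod (y - a)) * min 1 (cmod (y - b)) \<le> 2 * cmod (D y)"
      interpret small_divisors S s w B \<beta> by fact
      define g where "g = (\<lambda>k. complex_of_real l * f k)"
      obtain A where A: "0 \<le> A" "\<And>ks. ks \<in> lists S \<Longrightarrow> ks \<noteq> [] \<Longrightarrow> exp (- (h / 4 * wt s ks + A)) \<le> cmod (freq w ks - a)"
        using ap(1) unfolding apart_def by auto
      obtain A' where A': "0 \<le> A'" "\<And>ks. ks \<in> lists S \<Longrightarrow> ks \<noteq> [] \<Longrightarrow> exp (- (h / 4 * wt s ks + A')) \<le> cmod (freq w ks - b)"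
        using ap(2) unfolding apart_def by auto
      define u where "u k = c * \<bar>l\<bar> * (cmod (f k) * exp (h * s k))" for k
      have us: "u summable_on S" unfolding u_def by (intro summable_on_cmult_right fs)
      have "infsum u S = c * \<bar>l\<bar> * (\<Sum>\<^sub>\<infinity>k\<in>S. cmod (f k) * exp (h * s k))"
        unfolding u_def by (simp add: infsum_cmult_right')
      also have "\<dots> \<le> c * \<bar>l\<bar> * (\<bar>N\<bar> + 1)" using c fN by (intro mult_left_mono) auto
      also have "\<dots> < c * l0 * (\<bar>N\<bar> + 1)" using c l by (intro mult_strict_right_mono mult_strict_left_mono) auto
      also have "\<dots> = 1" using c by (simp add: l0_def)
      finally have u1: "infsum u S < 1" .
      have pu: "(\<lambda>ks. prod_list (map u ks)) summable_on lists S"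
        by (rule summable_on_prod_list[OF _ us u1]) (use c in \<open>auto simp: u_def\<close>)
      show "wcoef (\<lambda>k. complex_of_real l * f k) w D abs_summable_on lists S"
        unfolding g_def[symmetric]
      proof (rule Infinite_Sum.abs_summable_on_comparison_test'[OF summable_on_cmult_right[OF pu]])
        fix ks assume ks: "ks \<in> lists S"
        define M where "M = (\<Prod>i<length ks. min 1 (cmod (freq w (drop i ks) - a))) *
          (\<Prod>i<length ks. min 1 (cmod (freq w (drop i ks) - b)))"
        have "exp (- (2 * real (length ks) * x0 + h * wt s ks + A + A' + 2))
            = exp (- (real (length ks) * x0 + 2 * (h / 4) * wt s ks + A + 1))
              * exp (- (real (length ks) * x0 + 2 * (h / 4) * wt s ks + A' + 1))"
          by (simp flip: exp_add)
        also have "\<dots> \<le> M" unfolding M_def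
          using x0(2)[OF sd A ks] x0(2)[OF sd A' ks] by (intro mult_mono prod_nonneg) auto
        finally have M: "exp (- (2 * real (length ks) * x0 + h * wt s ks + A + A' + 2)) \<le> M" .
        have le: "cmod (wcoef g w D ks) * M \<le> prod_list (map (\<lambda>k. 2 * cmod (g k)) ks)"
          unfolding M_def
        proof (rule wcoef_mult_divisors_le[OF _ _ ks])
          fix ks assume ks: "ks \<in> lists S" "ks \<noteq> []"
          show "min 1 (cmod (freq w ks - a)) * min 1 (cmod (freq w ks - b)) \<le> 2 * cmod (D (freq w ks))"
            by (rule D) (rule norm_freq[OF ks(1)])
          moreover have "0 < min 1 (cmod (freq w ks - a)) * min 1 (cmod (freq w ks - b))"
            using apart_neq[OF ap(1) ks] apart_neq[OF ap(2) ks] by simp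
          ultimately show "D (freq w ks) \<noteq> 0" by auto
        qed
        define X where "X = 2 * real (length ks) * x0 + h * wt s ks + A + A' + 2"
        have "cmod (wcoef g w D ks) = cmod (wcoef g w D ks) * exp (- X) * exp X"
          by (simp add: exp_minus)
        also have "\<dots> \<le> cmod (wcoef g w D ks) * M * exp X"
          using M by (intro mult_right_mono mult_left_mono) (simp_all add: X_def)
        also have "\<dots> \<le> prod_list (map (\<lambda>k. 2 * cmod (g k)) ks) * exp X"
          using le by (intro mult_right_mono) auto
        also have "\<dots> = exp (A + A' + 2) * (prod_list (map (\<lambda>k. 2 * cmod (g k)) ks)
            * (exp (2 * real (length ks) * x0) * exp (h * wt s ks)))"
          by (simp add: X_def exp_add)
        also have "prod_list (map (\<lambda>k. 2 * cmod (g k)) ks)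
            * (exp (2 * real (length ks) * x0) * exp (h * wt s ks)) = prod_list (map u ks)"
          by (induction ks) (simp_all add: u_def c_def g_def norm_mult exp_add algebra_simps)
        finally show "cmod (wcoef g w D ks) \<le> exp (A + A' + 2) * prod_list (map u ks)" .
      qed
    qed
  qed
qed

subsection \<open>Green kernels\<close>

lemma ell2_norm_nonneg: "0 \<le> ell2_norm \<psi>"
  unfolding ell2_norm_def by (simp add: infsum_nonneg)

lemma ell2_norm_sq: "(ell2_norm \<psi>)\<^sup>2 = (\<Sum>\<^sub>\<infinity>n. (cmod (\<psi> n))\<^sup>2)"
  unfolding ell2_norm_def by (simp add: infsum_nonneg)

lemma norm_le_ell2_norm:
  assumes "\<psi> \<in> ell2"
  shows "cmod (\<psi> n) \<le> ell2_norm \<psi>"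
proof (rule power2_le_imp_le[OF _ ell2_norm_nonneg])
  have "(\<Sum>n\<in>{n}. (cmod (\<psi> n))\<^sup>2) \<le> (\<Sum>\<^sub>\<infinity>n. (cmod (\<psi> n))\<^sup>2)"
    using assms by (intro finite_sum_le_infsum) (auto simp: ell2_def)
  then show "(cmod (\<psi> n))\<^sup>2 \<le> (ell2_norm \<psi>)\<^sup>2" by (simp add: ell2_norm_sq)
qed

lemma summable_shift_int:
  fixes f :: "int \<Rightarrow> 'a :: {comm_monoid_add, topological_space}"
  shows "(\<lambda>n. f (n + j)) summable_on UNIV \<longleftrightarrow> f summable_on UNIV"
  using summable_on_reindex_bij_betw[OF bij_plus_right, of f j] by (simp add: add.commute)

lemma infsum_shift_int:
  fixes f :: "int \<Rightarrow> 'a :: {comm_monoid_add, t2_space}"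
  shows "(\<Sum>\<^sub>\<infinity>n. f (n + j)) = (\<Sum>\<^sub>\<infinity>n. f n)"
  using infsum_reindex_bij_betw[OF bij_plus_right, of f j] by (simp add: add.commute)

lemma kernel_summable:
  fixes G :: "int \<Rightarrow> int \<Rightarrow> complex" and \<gamma> :: "int \<Rightarrow> real"
  assumes \<gamma>: "\<gamma> summable_on UNIV" and G: "\<And>n m. cmod (G n m) \<le> \<gamma> (n - m)"
    and c: "\<And>m. cmod (\<phi> m) \<le> c"
  shows "(\<lambda>m. G n m * \<phi> m) abs_summable_on UNIV"
proof (rule Infinite_Sum.abs_summable_on_comparison_test')
  have "(\<lambda>m. \<gamma> (- m)) summable_on UNIV"
    using summable_on_reindex_bij_betw[OF bij_uminus, of \<gamma>] \<gamma> by simp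
  then have "(\<lambda>m. \<gamma> (- (m + (- n)))) summable_on UNIV"
    by (subst summable_shift_int[of "\<lambda>m. \<gamma> (- m)"])
  then show "(\<lambda>m. \<gamma> (n - m) * c) summable_on UNIV"
    by (intro summable_on_cmult_left) simp
  show "cmod (G n m * \<phi> m) \<le> \<gamma> (n - m) * c" for m
    unfolding norm_mult using G[of n m] c[of m] by (intro mult_mono) (auto intro: order_trans[OF norm_ge_zero])
qed

text \<open>Young's inequality for convolution with a summable majorant, by the Schur test: the
  operator norm is at most the sum of \<gamma>.\<close>

lemma bounded_operator_kernel:
  fixes G :: "int \<Rightarrow> int \<Rightarrow> complex" and \<gamma> :: "int \<Rightarrow> real"
  assumes \<gamma>: "\<gamma> summable_on UNIV" and G: "\<And>n m. cmod (G n m) \<le> \<gamma> (n - m)"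
  shows "bounded_operator (\<lambda>\<psi> n. \<Sum>\<^sub>\<infinity>m. G n m * \<psi> m)"
proof -
  define T where "T \<psi> n = (\<Sum>\<^sub>\<infinity>m. G n m * \<psi> m)" for \<psi> n
  define s where "s = (\<Sum>\<^sub>\<infinity>j. \<gamma> j)"
  have \<gamma>0: "0 \<le> \<gamma> j" for j using order_trans[OF norm_ge_zero G[of j 0]] by simp
  have s0: "0 \<le> s" unfolding s_def by (intro infsum_nonneg \<gamma>0)
  have sm: "(\<lambda>m. G n m * \<psi> m) summable_on UNIV" if "\<psi> \<in> ell2" for \<psi> n
    by (rule abs_summable_summable, rule kernel_summable[where c = "ell2_norm \<psi>", OF \<gamma> G])
      (rule norm_le_ell2_norm[OF that])
  have bd: "T \<psi> \<in> ell2 \<and> ell2_norm (T \<psi>) \<le> s * ell2_norm \<psi>" if \<psi>: "\<psi> \<in> ell2" for \<psi>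
  proof -
    define a where "a m = (cmod (\<psi> m))\<^sup>2" for m
    have a: "a summable_on UNIV" using \<psi> by (simp add: a_def[abs_def] ell2_def)
    have a0: "0 \<le> a m" for m by (simp add: a_def)
    have "(\<lambda>(j, m). \<gamma> j * a m) abs_summable_on UNIV \<times> UNIV"
      by (rule abs_summable_times) (use \<gamma> a \<gamma>0 a0 in auto)
    then have prod: "(\<lambda>(j, m). \<gamma> j * a m) summable_on UNIV \<times> UNIV"
      by (rule abs_summable_summable)
    \<comment> \<open>In the coordinates \<open>n - m\<close> and \<open>m\<close> the double sum of
      the convolution becomes a product of two sums.\<close>
    have bij: "bij_betw (\<lambda>(n, m). (n - m, m)) (UNIV \<times> UNIV) (UNIV \<times> (UNIV :: int set))"
      by (rule bij_betwI[where g = "\<lambda>(j, m). (j + m, m)"]) auto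
    have conv: "(\<lambda>(n, m). \<gamma> (n - m) * a m) summable_on UNIV \<times> UNIV"
      using summable_on_reindex_bij_betw[OF bij, of "\<lambda>(j, m). \<gamma> j * a m"] prod
      by (simp add: split_def)
    have conv_sum: "(\<Sum>\<^sub>\<infinity>(n, m)\<in>UNIV \<times> UNIV. \<gamma> (n - m) * a m) = s * (\<Sum>\<^sub>\<infinity>m. a m)"
      using infsum_reindex_bij_betw[OF bij, of "\<lambda>(j, m). \<gamma> j * a m"]
        infsum_times[of \<gamma> UNIV a UNIV] \<gamma> a \<gamma>0 a0
      by (simp add: split_def s_def)
    define b where "b n = (\<Sum>\<^sub>\<infinity>m. \<gamma> (n - m) * a m)" for n
    have b: "(b has_sum (s * (\<Sum>\<^sub>\<infinity>m. a m))) UNIV"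
    proof -
      have "b summable_on UNIV" unfolding b_def
        using summable_on_Sigma_banach[OF conv] by simp
      moreover have "infsum b UNIV = s * (\<Sum>\<^sub>\<infinity>m. a m)"
        unfolding conv_sum[symmetric] b_def using infsum_Sigma_banach[OF conv] by simp
      ultimately show ?thesis by (simp add: has_sum_iff)
    qed
    have row: "(\<lambda>m. \<gamma> (n - m) * a m) summable_on UNIV" for n
      using summable_on_SigmaD1[OF conv, of n] by simp
    have \<gamma>n: "(\<lambda>m. \<gamma> (n - m)) summable_on UNIV" "(\<Sum>\<^sub>\<infinity>m. \<gamma> (n - m)) = s" for n
    proof -
      have bij': "bij_betw (\<lambda>m. n - m) UNIV UNIV"
        by (rule bij_betwI[where g = "\<lambda>m. n - m"]) auto
      show "(\<lambda>m. \<gamma> (n - m)) summable_on UNIV" "(\<Sum>\<^sub>\<infinity>m. \<gamma> (n - m)) = s"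
        using summable_on_reindex_bij_betw[OF bij', of \<gamma>] infsum_reindex_bij_betw[OF bij', of \<gamma>] \<gamma>
        by (simp_all add: s_def)
    qed
    have pt: "(cmod (T \<psi> n))\<^sup>2 \<le> s * b n" for n
    proof -
      have b0: "0 \<le> b n" unfolding b_def by (intro infsum_nonneg mult_nonneg_nonneg \<gamma>0 a0)
      have as: "(\<lambda>m. G n m * \<psi> m) abs_summable_on UNIV"
        by (rule kernel_summable[where c = "ell2_norm \<psi>", OF \<gamma> G]) (rule norm_le_ell2_norm[OF \<psi>])
      have "cmod (T \<psi> n) \<le> (\<Sum>\<^sub>\<infinity>m. cmod (G n m * \<psi> m))"
        unfolding T_def by (rule norm_infsum_bound[OF as])
      also have "\<dots> \<le> sqrt (s * b n)"
      proof (rule infsum_le_finite_sums[OF as])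
        fix F :: "int set" assume F: "finite F"
        \<comment> \<open>Half of the kernel is kept apart from \<open>\<psi>\<close>, so that
          Cauchy-Schwarz yields the factor \<open>s\<close> and the convolution
          \<open>b n\<close>.\<close>
        have "(\<Sum>m\<in>F. cmod (G n m * \<psi> m)) \<le> (\<Sum>m\<in>F. sqrt (\<gamma> (n - m)) * (sqrt (\<gamma> (n - m)) * cmod (\<psi> m)))"
          by (intro sum_mono) (simp add: norm_mult mult_right_mono G \<gamma>0 flip: mult.assoc)
        also have "\<dots> \<le> sqrt (s * b n)"
        proof (rule real_le_rsqrt)
          have "(\<Sum>m\<in>F. sqrt (\<gamma> (n - m)) * (sqrt (\<gamma> (n - m)) * cmod (\<psi> m)))\<^sup>2
              \<le> (\<Sum>m\<in>F. (sqrt (\<gamma> (n - m)))\<^sup>2) * (\<Sum>m\<in>F. (sqrt (\<gamma> (n - m)) * cmod (\<psi> m))\<^sup>2)"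
            by (rule Cauchy_Schwarz_ineq_sum)
          also have "\<dots> = (\<Sum>m\<in>F. \<gamma> (n - m)) * (\<Sum>m\<in>F. \<gamma> (n - m) * a m)"
            by (simp add: \<gamma>0 power_mult_distrib a_def)
          also have "\<dots> \<le> s * b n"
          proof (rule mult_mono)
            show "(\<Sum>m\<in>F. \<gamma> (n - m)) \<le> s"
              unfolding \<gamma>n(2)[of n, symmetric] by (rule finite_sum_le_infsum[OF \<gamma>n(1) F]) (auto simp: \<gamma>0)
            show "(\<Sum>m\<in>F. \<gamma> (n - m) * a m) \<le> b n"
              unfolding b_def by (rule finite_sum_le_infsum[OF row F]) (auto simp: \<gamma>0 a0)
          qed (auto intro!: sum_nonneg mult_nonneg_nonneg simp: s0 \<gamma>0 a0)
          finally show "(\<Sum>m\<in>F. sqrt (\<gamma> (n - m)) * (sqrt (\<gamma> (n - m)) * cmod (\<psi> m)))\<^sup>2 \<le> s * b n" .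
        qed
        finally show "(\<Sum>m\<in>F. cmod (G n m * \<psi> m)) \<le> sqrt (s * b n)" .
      qed
      finally have "(cmod (T \<psi> n))\<^sup>2 \<le> (sqrt (s * b n))\<^sup>2" by (intro power_mono) auto
      then show ?thesis using s0 b0 by simp
    qed
    have sb: "((\<lambda>n. s * b n) has_sum (s * (s * (\<Sum>\<^sub>\<infinity>m. a m)))) UNIV"
      by (rule has_sum_cmult_right[OF b])
    have "(\<lambda>n. norm ((cmod (T \<psi> n))\<^sup>2)) summable_on UNIV"
      by (rule Infinite_Sum.abs_summable_on_comparison_test'[OF has_sum_imp_summable[OF sb]]) (use pt in auto)
    then have Ts: "(\<lambda>n. (cmod (T \<psi> n))\<^sup>2) summable_on UNIV" by simp
    have "(ell2_norm (T \<psi>))\<^sup>2 \<le> s * (s * (\<Sum>\<^sub>\<infinity>m. a m))"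
      unfolding ell2_norm_sq by (rule has_sum_mono[OF has_sum_infsum[OF Ts] sb]) (rule pt)
    also have "\<dots> = (s * ell2_norm \<psi>)\<^sup>2"
      by (simp add: power_mult_distrib ell2_norm_sq a_def power2_eq_square[of s])
    finally have "ell2_norm (T \<psi>) \<le> s * ell2_norm \<psi>"
      by (rule power2_le_imp_le) (simp add: s0 ell2_norm_nonneg)
    then show ?thesis using Ts by (simp add: ell2_def)
  qed
  have "bounded_operator T"
    unfolding bounded_operator_def
  proof (intro conjI ballI allI)
    fix \<psi> \<phi> assume "\<psi> \<in> ell2" "\<phi> \<in> ell2"
    then show "T (\<lambda>n. \<psi> n + \<phi> n) = (\<lambda>n. T \<psi> n + T \<phi> n)"
      using infsum_add[OF sm[of \<psi>] sm[of \<phi>]] by (simp add: fun_eq_iff T_def distrib_left)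
  next
    fix a \<psi> assume "\<psi> \<in> ell2"
    show "T (\<lambda>n. a * \<psi> n) = (\<lambda>n. a * T \<psi> n)"
      by (simp add: fun_eq_iff T_def mult.left_commute[of _ a] infsum_cmult_right')
  qed (use bd in auto)
  then show ?thesis unfolding T_def .
qed

text \<open>The difference equation in the first variable of \<open>G\<close> makes \<open>R\<close>
  a right inverse. Symmetry transfers it to the second variable, where summation by parts makes
  \<open>R\<close> a left inverse as well; no self-adjointness is involved.\<close>

lemma not_in_spectrum_green:
  fixes V :: "int \<Rightarrow> complex" and G :: "int \<Rightarrow> int \<Rightarrow> complex" and \<gamma> :: "int \<Rightarrow> real"
  assumes V: "\<And>n. cmod (V n) \<le> b" and \<gamma>: "\<gamma> summable_on UNIV"
    and G: "\<And>n m. cmod (G n m) \<le> \<gamma> (n - m)" and sym: "\<And>n m. G n m = G m n"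
    and green: "\<And>n m. G (n + 1) m + G (n - 1) m + V n * G n m - E * G n m = of_bool (n = m)"
  shows "E \<notin> spectrum (\<lambda>\<psi> n. \<psi> (n + 1) + \<psi> (n - 1) + V n * \<psi> n)"
proof -
  define R where "R \<psi> n = (\<Sum>\<^sub>\<infinity>m. G n m * \<psi> m)" for \<psi> n
  have R: "bounded_operator R" unfolding R_def by (rule bounded_operator_kernel[OF \<gamma> G])
  have delta: "(\<Sum>\<^sub>\<infinity>m. of_bool (n = m) * \<psi> m) = \<psi> n" for \<psi> :: "int \<Rightarrow> complex" and n
  proof -
    have "(\<Sum>\<^sub>\<infinity>m. of_bool (n = m) * \<psi> m) = (\<Sum>\<^sub>\<infinity>m\<in>{n}. of_bool (n = m) * \<psi> m)"
      by (rule infsum_cong_neutral) auto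
    then show ?thesis by simp
  qed
  have "R (\<lambda>n. \<psi> (n + 1) + \<psi> (n - 1) + V n * \<psi> n - E * \<psi> n) = \<psi> \<and>
      (\<lambda>n. R \<psi> (n + 1) + R \<psi> (n - 1) + V n * R \<psi> n - E * R \<psi> n) = \<psi>" if \<psi>: "\<psi> \<in> ell2" for \<psi>
  proof
    define c where "c = ell2_norm \<psi>"
    have c: "cmod (\<psi> m) \<le> c" for m unfolding c_def by (rule norm_le_ell2_norm[OF \<psi>])
    have sm: "(\<lambda>m. G n m * \<phi> m) summable_on UNIV" if "\<And>m. cmod (\<phi> m) \<le> c'" for \<phi> c' n
      by (rule abs_summable_summable, rule kernel_summable[OF \<gamma> G that])
    have hs: "((\<lambda>m. G n m * \<psi> m) has_sum R \<psi> n) UNIV" for n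
      unfolding R_def by (rule has_sum_infsum[OF sm[OF c]])
    show "(\<lambda>n. R \<psi> (n + 1) + R \<psi> (n - 1) + V n * R \<psi> n - E * R \<psi> n) = \<psi>"
    proof
      fix n
      have "((\<lambda>m. G (n + 1) m * \<psi> m + G (n - 1) m * \<psi> m + V n * (G n m * \<psi> m) + (- E) * (G n m * \<psi> m)) has_sum
          (R \<psi> (n + 1) + R \<psi> (n - 1) + V n * R \<psi> n + (- E) * R \<psi> n)) UNIV"
        by (rule has_sum_add[OF has_sum_add[OF has_sum_add[OF hs hs]
              has_sum_cmult_right[OF hs]] has_sum_cmult_right[OF hs]])
      also have "(\<lambda>m. G (n + 1) m * \<psi> m + G (n - 1) m * \<psi> m + V n * (G n m * \<psi> m) + (- E) * (G n m * \<psi> m))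
          = (\<lambda>m. of_bool (n = m) * \<psi> m)"
        unfolding green[symmetric] by (simp add: algebra_simps)
      finally show "R \<psi> (n + 1) + R \<psi> (n - 1) + V n * R \<psi> n - E * R \<psi> n = \<psi> n"
        using infsumI delta[of n \<psi>] by fastforce
    qed
    show "R (\<lambda>n. \<psi> (n + 1) + \<psi> (n - 1) + V n * \<psi> n - E * \<psi> n) = \<psi>"
    proof
      fix n
      \<comment> \<open>Summation by parts: both shifts move from \<open>\<psi>\<close> to the
        kernel, without boundary terms since all the series converge absolutely.\<close>
      have up: "((\<lambda>m. G n m * \<psi> (m + 1)) has_sum (\<Sum>\<^sub>\<infinity>m. G n (m - 1) * \<psi> m)) UNIV"
        using has_sum_infsum[OF sm[of "\<lambda>m. \<psi> (m + 1)" c n, OF c]]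
          infsum_shift_int[of "\<lambda>m. G n (m - 1) * \<psi> m" 1] by simp
      have up_s: "(\<lambda>m. G n (m - 1) * \<psi> m) summable_on UNIV"
        using summable_shift_int[of "\<lambda>m. G n (m - 1) * \<psi> m" 1] sm[of "\<lambda>m. \<psi> (m + 1)" c n, OF c] by simp
      have dn: "((\<lambda>m. G n m * \<psi> (m - 1)) has_sum (\<Sum>\<^sub>\<infinity>m. G n (m + 1) * \<psi> m)) UNIV"
        using has_sum_infsum[OF sm[of "\<lambda>m. \<psi> (m - 1)" c n, OF c]]
          infsum_shift_int[of "\<lambda>m. G n (m + 1) * \<psi> m" "-1"] by simp
      have dn_s: "(\<lambda>m. G n (m + 1) * \<psi> m) summable_on UNIV"
        using summable_shift_int[of "\<lambda>m. G n (m + 1) * \<psi> m" "-1"] sm[of "\<lambda>m. \<psi> (m - 1)" c n, OF c] by simp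
      have Vs: "(\<lambda>m. G n m * (V m * \<psi> m)) summable_on UNIV"
        by (rule sm[where c' = "b * c"])
          (unfold norm_mult, intro mult_mono V c, auto intro: order_trans[OF norm_ge_zero V])
      have "((\<lambda>m. G n m * \<psi> (m + 1) + G n m * \<psi> (m - 1) + G n m * (V m * \<psi> m) + (- E) * (G n m * \<psi> m)) has_sum
          ((\<Sum>\<^sub>\<infinity>m. G n (m - 1) * \<psi> m) + (\<Sum>\<^sub>\<infinity>m. G n (m + 1) * \<psi> m)
            + (\<Sum>\<^sub>\<infinity>m. G n m * (V m * \<psi> m)) + (- E) * R \<psi> n)) UNIV"
        by (rule has_sum_add[OF has_sum_add[OF has_sum_add[OF up dn] has_sum_infsum[OF Vs]]
              has_sum_cmult_right[OF hs]])
      moreover have "((\<lambda>m. G n (m - 1) * \<psi> m + G n (m + 1) * \<psi> m + G n m * (V m * \<psi> m) + (- E) * (G n m * \<psi> m)) has_sum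
          ((\<Sum>\<^sub>\<infinity>m. G n (m - 1) * \<psi> m) + (\<Sum>\<^sub>\<infinity>m. G n (m + 1) * \<psi> m)
            + (\<Sum>\<^sub>\<infinity>m. G n m * (V m * \<psi> m)) + (- E) * R \<psi> n)) UNIV"
        by (rule has_sum_add[OF has_sum_add[OF has_sum_add[OF has_sum_infsum[OF up_s] has_sum_infsum[OF dn_s]] has_sum_infsum[OF Vs]]
              has_sum_cmult_right[OF hs]])
      ultimately have "(\<Sum>\<^sub>\<infinity>m. G n m * \<psi> (m + 1) + G n m * \<psi> (m - 1) + G n m * (V m * \<psi> m) + (- E) * (G n m * \<psi> m))
          = (\<Sum>\<^sub>\<infinity>m. G n (m - 1) * \<psi> m + G n (m + 1) * \<psi> m + G n m * (V m * \<psi> m) + (- E) * (G n m * \<psi> m))"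
        by (simp only: infsumI)
      also have "\<dots> = (\<Sum>\<^sub>\<infinity>m. of_bool (n = m) * \<psi> m)"
      proof (rule infsum_cong)
        fix m
        have "of_bool (n = m) = G n (m + 1) + G n (m - 1) + V m * G n m - E * G n m"
          using green[of m n] by (simp add: sym[of n] eq_commute)
        then show "G n (m - 1) * \<psi> m + G n (m + 1) * \<psi> m + G n m * (V m * \<psi> m) + (- E) * (G n m * \<psi> m)
            = of_bool (n = m) * \<psi> m"
          by (simp only:) (simp add: algebra_simps)
      qed
      finally show "R (\<lambda>n. \<psi> (n + 1) + \<psi> (n - 1) + V n * \<psi> n - E * \<psi> n) n = \<psi> n"
        unfolding R_def delta by (simp add: algebra_simps)
    qed
  qed
  then show ?thesis unfolding spectrum_def using R by blast
qed

subsection \<open>The spectrum of a one-sided potential\<close>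

text \<open>For nonzero \<open>t\<close>, \<open>y\<close>, \<open>z\<close> this is
  \<open>(t * y - z) * (t * y - inverse z) / (t * y)\<close>, with zeros at \<open>y = z / t\<close>
  and \<open>y = inverse (z * t)\<close>: the two points from which frequencies must stay
  apart.\<close>

definition symb :: "complex \<Rightarrow> complex \<Rightarrow> complex \<Rightarrow> complex" where
  "symb t z y = t * y + inverse (t * y) - (z + inverse z)"

lemma symb_1: "symb z z 1 = 0" "symb (inverse z) z 1 = 0"
  by (simp_all add: symb_def)

text \<open>The constant must not depend on \<open>z\<close>. For \<open>z\<close> near 0 the second
  zero escapes to infinity while its prefactor \<open>z\<close> degenerates, but then the whole
  factor \<open>z * y - inverse z\<close> is large; otherwise pulling out \<open>z\<close> loses at
  most a factor 2.\<close>

lemma symb_lower_bound: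
  assumes z: "z \<noteq> 0" "cmod z < 1" and y: "cmod y = 1"
  shows "min 1 (cmod (y - 1)) * min 1 (cmod (y - inverse (z\<^sup>2))) \<le> 2 * cmod (symb z z y)"
proof -
  have y0: "y \<noteq> 0" using y by auto
  have "symb z z y = (y - 1) * (z * y - inverse z) / y"
    using z y0 by (simp add: symb_def field_simps)
  then have eq: "cmod (symb z z y) = cmod (y - 1) * cmod (z * y - inverse z)"
    using y by (simp add: norm_mult norm_divide)
  have "min 1 (cmod (y - inverse (z\<^sup>2))) \<le> 2 * cmod (z * y - inverse z)"
  proof (cases "cmod z < 1 / 2")
    case True
    have "2 \<le> 1 / cmod z" using True z by (simp add: le_divide_eq)
    moreover have "cmod (inverse z) - cmod (z * y) \<le> cmod (z * y - inverse z)"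
      by (metis norm_minus_commute norm_triangle_ineq2)
    moreover have "cmod (inverse z) = 1 / cmod z" "cmod (z * y) = cmod z"
      using y by (simp_all add: norm_mult norm_inverse norm_divide inverse_eq_divide)
    ultimately have "1 \<le> 2 * cmod (z * y - inverse z)" using True by linarith
    then show ?thesis by simp
  next
    case False
    have "z * y - inverse z = z * (y - inverse (z\<^sup>2))"
      using z by (simp add: field_simps power2_eq_square)
    then have "2 * cmod (z * y - inverse z) = (2 * cmod z) * cmod (y - inverse (z\<^sup>2))"
      by (simp add: norm_mult)
    also have "\<dots> \<ge> 1 * cmod (y - inverse (z\<^sup>2))"
      using False by (intro mult_right_mono) auto
    finally show ?thesis by simp
  qed
  then have "min 1 (cmod (y - 1)) * min 1 (cmod (y - inverse (z\<^sup>2))) \<le> cmod (y - 1) * (2 * cmod (z * y - inverse z))"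
    by (intro mult_mono) auto
  then show ?thesis by (simp add: eq)
qed

lemma symb_inverse_lower_bound:
  assumes z: "z \<noteq> 0" "cmod z < 1" and y: "cmod y = 1"
  shows "min 1 (cmod (y - 1)) * min 1 (cmod (y - z\<^sup>2)) \<le> 2 * cmod (symb (inverse z) z y)"
proof -
  have y0: "y \<noteq> 0" using y by auto
  have "symb (inverse z) z y = (y - 1) * (y - z\<^sup>2) / (z * y)"
    using z y0 by (simp add: symb_def field_simps power2_eq_square)
  then have eq: "cmod (symb (inverse z) z y) = cmod (y - 1) * cmod (y - z\<^sup>2) / cmod z"
    using y by (simp add: norm_mult norm_divide)
  have "min 1 (cmod (y - 1)) * min 1 (cmod (y - z\<^sup>2)) \<le> cmod (y - 1) * cmod (y - z\<^sup>2)"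
    by (intro mult_mono) auto
  also have "\<dots> \<le> cmod (y - 1) * cmod (y - z\<^sup>2) / cmod z"
    using z by (simp add: le_divide_eq mult_left_le)
  finally show ?thesis unfolding eq
    by (smt (verit) divide_nonneg_nonneg mult_nonneg_nonneg norm_ge_zero)
qed

lemma symb_circle_lower_bound:
  assumes z: "z \<noteq> 0" and t: "cmod t = 1" and y: "cmod y = 1"
  shows "min 1 (cmod (y - z / t)) * min 1 (cmod (y - inverse (z * t))) \<le> 2 * cmod (symb t z y)"
proof -
  have t0: "t \<noteq> 0" using t by auto
  have y0: "y \<noteq> 0" using y by auto
  have "symb t z y = t * (y - z / t) * (y - inverse (z * t)) / y"
    using z y0 t0 by (simp add: symb_def field_simps)
  then have eq: "cmod (symb t z y) = cmod (y - z / t) * cmod (y - inverse (z * t))"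
    using y t by (simp add: norm_mult norm_divide)
  have "min 1 (cmod (y - z / t)) * min 1 (cmod (y - inverse (z * t))) \<le> cmod (symb t z y)"
    unfolding eq by (intro mult_mono) auto
  then show ?thesis using norm_ge_zero[of "symb t z y"] by linarith
qed

text \<open>The roots of \<open>u\<^sup>2 - E * u + 1\<close> are inverse to each other. On the unit
  circle they would be conjugate and \<open>E = 2 * Re u\<close> would lie in the interval, so one
  of them is inside the disc.\<close>

lemma exists_joukowski_preimage:
  assumes "E \<notin> complex_of_real ` {-2..2}"
  obtains z where "z \<noteq> 0" "cmod z < 1" "E = z + inverse z"
proof -
  define u where "u = (E + csqrt (E\<^sup>2 - 4)) / 2"
  have u: "u * (E - u) = 1"
  proof -
    have "u * (E - u) = (E\<^sup>2 - (csqrt (E\<^sup>2 - 4))\<^sup>2) / 4"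
      by (simp add: u_def field_simps power2_eq_square)
    then show ?thesis by simp
  qed
  then have u0: "u \<noteq> 0" and iu: "inverse u = E - u"
    by (auto simp: inverse_unique)
  have E: "E = u + inverse u" by (simp add: iu)
  have "cmod u \<noteq> 1"
  proof
    assume n: "cmod u = 1"
    then have "inverse u = cnj u"
      by (simp add: inverse_complex_def complex_eq_iff cmod_power2[symmetric] power2_eq_square[symmetric] flip: cmod_power2)
    then have "E = complex_of_real (2 * Re u)" using E complex_add_cnj[of u] by simp
    moreover have "\<bar>Re u\<bar> \<le> 1" using abs_Re_le_cmod[of u] n by simp
    ultimately have "E \<in> complex_of_real ` {-2..2}" by (simp only:) (rule imageI, auto)
    then show False using assms by contradiction
  qed
  then consider "cmod u < 1" | "1 < cmod u" by linarith
  then show ?thesis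
  proof cases
    case 1
    then show ?thesis using that[of u] u0 E by simp
  next
    case 2
    then have "cmod (inverse u) < 1" by (simp add: norm_inverse inverse_less_1_iff)
    then show ?thesis using that[of "inverse u"] u0 E by (simp add: add.commute)
  qed
qed

lemma summable_power_abs_int:
  fixes x :: real
  assumes "0 \<le> x" "x < 1"
  shows "(\<lambda>j::int. x ^ nat \<bar>j\<bar>) summable_on UNIV"
proof -
  have g: "(\<lambda>n. x ^ n) summable_on UNIV"
    using assms by (intro norm_summable_imp_summable_on) (simp add: power_abs[symmetric] summable_geometric)
  have i1: "inj int" "inj (\<lambda>n. - int n)" by (auto simp: inj_on_def)
  have "(\<lambda>j::int. x ^ nat \<bar>j\<bar>) summable_on range int"
    unfolding summable_on_reindex[OF i1(1)] using g by (simp add: comp_def)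
  moreover have "(\<lambda>j::int. x ^ nat \<bar>j\<bar>) summable_on range (\<lambda>n. - int n)"
    unfolding summable_on_reindex[OF i1(2)] using g by (simp add: comp_def)
  ultimately have "(\<lambda>j::int. x ^ nat \<bar>j\<bar>) summable_on (range int \<union> range (\<lambda>n. - int n))"
    by (rule summable_on_union)
  moreover have "range int \<union> range (\<lambda>n. - int n) = (UNIV :: int set)"
    by (auto simp: image_iff) (metis int_cases2)
  ultimately show ?thesis by simp
qed

text \<open>Smallness of the coupling enters only through \<open>wcoef_summable\<close>, imposed for
  all pairs of points and all symbols at once; the coupling constant and the phase are absorbed into
  \<open>g\<close>.\<close>

locale one_sided = small_divisors S s w B \<beta>
  for S :: "'k set" and s w B \<beta> +
  fixes g :: "'k \<Rightarrow> complex" and \<kappa> :: real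
  assumes B_pos: "0 < B" and \<beta>_bounds: "0 < \<beta>" "\<beta> < 1" and \<kappa>_pos: "0 < \<kappa>"
    and g_summable: "g abs_summable_on S"
    and wcoef_summable: "\<lbrakk>apart \<kappa> a; apart \<kappa> b;
        \<And>y. cmod y = 1 \<Longrightarrow> min 1 (cmod (y - a)) * min 1 (cmod (y - b)) \<le> 2 * cmod (D y)\<rbrakk>
      \<Longrightarrow> wcoef g w D abs_summable_on lists S"
begin

definition V :: "int \<Rightarrow> complex" where
  "V n = (\<Sum>\<^sub>\<infinity>k\<in>S. g k * w k powi n)"

definition H :: "(int \<Rightarrow> complex) \<Rightarrow> int \<Rightarrow> complex" where
  "H \<psi> = (\<lambda>n. \<psi> (n + 1) + \<psi> (n - 1) + V n * \<psi> n)"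

lemma norm_V_le: "cmod (V n) \<le> (\<Sum>\<^sub>\<infinity>k\<in>S. cmod (g k))"
proof -
  have as: "(\<lambda>k. g k * w k powi n) abs_summable_on S"
    by (rule Infinite_Sum.abs_summable_on_comparison_test[OF g_summable])
      (simp add: norm_mult norm_power_int norm_w)
  show ?thesis unfolding V_def
    by (rule norm_infsum_le[OF has_sum_infsum[OF abs_summable_summable[OF as]] has_sum_infsum[OF g_summable]])
      (simp add: norm_mult norm_power_int norm_w)
qed

lemma wave_solves:
  assumes a: "apart \<kappa> a" and b: "apart \<kappa> b" and t: "t \<noteq> 0"
    and bd: "\<And>y. cmod y = 1 \<Longrightarrow> min 1 (cmod (y - a)) * min 1 (cmod (y - b)) \<le> 2 * cmod (symb t z y)"
  shows "wcoef g w (symb t z) abs_summable_on lists S"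
    and "H (wave S g w (symb t z) t) n - (z + inverse z) * wave S g w (symb t z) t n = symb t z 1 * t powi n"
proof -
  show ws: "wcoef g w (symb t z) abs_summable_on lists S"
    by (rule wcoef_summable[OF a b bd])
  show "H (wave S g w (symb t z) t) n - (z + inverse z) * wave S g w (symb t z) t n = symb t z 1 * t powi n"
    unfolding H_def V_def
  proof (rule wave_equation[OF ws g_summable _ t])
    fix ks assume ks: "ks \<in> lists S" "ks \<noteq> []"
    have "0 < min 1 (cmod (freq w ks - a)) * min 1 (cmod (freq w ks - b))"
      using apart_neq[OF a ks] apart_neq[OF b ks] by simp
    also have "\<dots> \<le> 2 * cmod (symb t z (freq w ks))" by (rule bd) (rule norm_freq[OF ks(1)])
    finally show "symb t z (freq w ks) \<noteq> 0" by auto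
  qed (simp add: symb_def)
qed

text \<open>The two waves with \<open>t = z\<close> and \<open>t = inverse z\<close> play the role of the Jost solutions. Averaged over
  the lattice, only the constant mode of their Wronskian survives, so it equals the free one.\<close>

lemma wronskian_waves:
  assumes z: "z \<noteq> 0" "cmod z < 1"
    and p: "wcoef g w (symb z z) abs_summable_on lists S"
    and m: "wcoef g w (symb (inverse z) z) abs_summable_on lists S"
    and const: "\<And>n. wave S g w (symb z z) z (n + 1) * wave S g w (symb (inverse z) z) (inverse z) n
        - wave S g w (symb z z) z n * wave S g w (symb (inverse z) z) (inverse z) (n + 1) = W"
  shows "W = z - inverse z"
proof -
  define cp cm where "cp = wcoef g w (symb z z)" and "cm = wcoef g w (symb (inverse z) z)"
  note c_defs = cp_def[symmetric] cm_def[symmetric]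
  define I where "I = lists S \<times> lists S"
  \<comment> \<open>The growth of one wave cancels the decay of the other, which leaves unimodular
    modes; the unit shifts in the Wronskian give the last factor.\<close>
  define a where "a = (\<lambda>(ks, ls). cp ks * cm ls * (z * freq w ks - inverse z * freq w ls))"
  define \<rho> where "\<rho> = (\<lambda>(ks, ls). freq w ks * freq w ls)"
  have sp: "(\<lambda>ks. cp ks * (z * freq w ks) powi n) abs_summable_on lists S" for n
    unfolding cp_def by (rule abs_summable_wave[OF p])
  have sm: "(\<lambda>ks. cm ks * (inverse z * freq w ks) powi n) abs_summable_on lists S" for n
    unfolding cm_def by (rule abs_summable_wave[OF m])
  have W: "W = (\<Sum>\<^sub>\<infinity>i\<in>I. a i * \<rho> i ^ n)" for n
  proof -
    have 1: "((\<lambda>(ks, ls). (cp ks * (z * freq w ks) powi i) * (cm ls * (inverse z * freq w ls) powi j)) has_sum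
        (wave S g w (symb z z) z i * wave S g w (symb (inverse z) z) (inverse z) j)) I" for i j
      unfolding wave_def c_defs I_def infsum_times[OF sp sm]
      by (rule has_sum_infsum) (rule abs_summable_summable[OF abs_summable_times[OF sp sm]])
    have "((\<lambda>x. (case x of (ks, ls) \<Rightarrow> (cp ks * (z * freq w ks) powi (int n + 1)) * (cm ls * (inverse z * freq w ls) powi int n))
          + (- 1) * (case x of (ks, ls) \<Rightarrow> (cp ks * (z * freq w ks) powi int n) * (cm ls * (inverse z * freq w ls) powi (int n + 1))))
        has_sum (wave S g w (symb z z) z (int n + 1) * wave S g w (symb (inverse z) z) (inverse z) (int n)
          + (- 1) * (wave S g w (symb z z) z (int n) * wave S g w (symb (inverse z) z) (inverse z) (int n + 1)))) I"
      by (intro has_sum_add has_sum_cmult_right 1)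
    also have "wave S g w (symb z z) z (int n + 1) * wave S g w (symb (inverse z) z) (inverse z) (int n)
          + (- 1) * (wave S g w (symb z z) z (int n) * wave S g w (symb (inverse z) z) (inverse z) (int n + 1)) = W"
      using const[of "int n"] by simp
    finally have hs: "((\<lambda>x. (case x of (ks, ls) \<Rightarrow> (cp ks * (z * freq w ks) powi (int n + 1)) * (cm ls * (inverse z * freq w ls) powi int n))
          + (- 1) * (case x of (ks, ls) \<Rightarrow> (cp ks * (z * freq w ks) powi int n) * (cm ls * (inverse z * freq w ls) powi (int n + 1))))
        has_sum W) I" .
    have "((\<lambda>i. a i * \<rho> i ^ n) has_sum W) I"
    proof (rule iffD1[OF has_sum_cong hs])
      fix x assume "x \<in> I"
      then obtain ks ls where x: "x = (ks, ls)" "ks \<in> lists S" "ls \<in> lists S" by (auto simp: I_def)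
      have nz: "freq w ks \<noteq> 0" "freq w ls \<noteq> 0" using x freq_neq_0 by auto
      have zz: "z ^ n * inverse z ^ n = 1" using z by (simp flip: power_mult_distrib)
      have "(z * freq w ks) powi (int n + 1) * (inverse z * freq w ls) powi int n
          - (z * freq w ks) powi int n * (inverse z * freq w ls) powi (int n + 1)
          = (z * freq w ks - inverse z * freq w ls) * (z ^ n * inverse z ^ n) * (freq w ks * freq w ls) ^ n"
        using nz z by (simp add: power_int_add power_mult_distrib algebra_simps)
      then have "(z * freq w ks) powi (int n + 1) * (inverse z * freq w ls) powi int n
          - (z * freq w ks) powi int n * (inverse z * freq w ls) powi (int n + 1)
          = (z * freq w ks - inverse z * freq w ls) * (freq w ks * freq w ls) ^ n"
        unfolding zz by simp
      then have "cp ks * cm ls * ((z * freq w ks) powi (int n + 1) * (inverse z * freq w ls) powi int n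
          - (z * freq w ks) powi int n * (inverse z * freq w ls) powi (int n + 1)) = a x * \<rho> x ^ n"
        by (simp add: a_def \<rho>_def x)
      then show "(case x of (ks, ls) \<Rightarrow> (cp ks * (z * freq w ks) powi (int n + 1)) * (cm ls * (inverse z * freq w ls) powi int n))
          + (- 1) * (case x of (ks, ls) \<Rightarrow> (cp ks * (z * freq w ks) powi int n) * (cm ls * (inverse z * freq w ls) powi (int n + 1)))
          = a x * \<rho> x ^ n"
        by (simp add: x algebra_simps)
    qed
    then show ?thesis by (rule infsumI[symmetric])
  qed
  have "(\<lambda>N. (\<Sum>n<N. \<Sum>\<^sub>\<infinity>i\<in>I. a i * \<rho> i ^ n) / of_nat N) \<longlonglongrightarrow> a ([], [])"
  proof (rule mean_of_exponential_sum_tendsto)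
    have "(\<lambda>x. (cmod z + cmod (inverse z)) * cmod (case x of (ks, ls) \<Rightarrow> cp ks * cm ls)) summable_on I"
      unfolding I_def using p m
      by (intro summable_on_cmult_right abs_summable_times) (auto simp: cp_def cm_def)
    then show "a abs_summable_on I"
    proof (rule Infinite_Sum.abs_summable_on_comparison_test')
      fix x assume "x \<in> I"
      then obtain ks ls where x: "x = (ks, ls)" "ks \<in> lists S" "ls \<in> lists S" by (auto simp: I_def)
      have "cmod (z * freq w ks - inverse z * freq w ls) \<le> cmod (z * freq w ks) + cmod (inverse z * freq w ls)"
        by (rule norm_triangle_ineq4)
      also have "\<dots> = cmod z + cmod (inverse z)" using x by (simp only: norm_mult norm_freq mult_1_right)
      finally have "cmod (cp ks * cm ls) * cmod (z * freq w ks - inverse z * freq w ls)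
          \<le> cmod (cp ks * cm ls) * (cmod z + cmod (inverse z))"
        by (intro mult_left_mono) auto
      then show "cmod (a x) \<le> (cmod z + cmod (inverse z)) * cmod (case x of (ks, ls) \<Rightarrow> cp ks * cm ls)"
        by (simp add: a_def x norm_mult mult.commute)
    qed
    show "cmod (\<rho> i) = 1" if i: "i \<in> I" for i
    proof -
      obtain ks ls where "i = (ks, ls)" "ks \<in> lists S" "ls \<in> lists S" using i by (auto simp: I_def)
      then show ?thesis by (simp only: \<rho>_def prod.case norm_mult norm_freq mult_1)
    qed
    show "([], []) \<in> I" "\<rho> ([], []) = 1" by (auto simp: I_def \<rho>_def)
    fix i assume i: "i \<in> I" "i \<noteq> ([], [])"
    \<comment> \<open>Both waves use exponents from the same \<open>S\<close>, so the mode of a pair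
      is the frequency of the concatenated word and differs from 1 unless both words are
      empty.\<close>
    then obtain ks ls where x: "i = (ks, ls)" "ks @ ls \<in> lists S" "ks @ ls \<noteq> []" by (auto simp: I_def)
    show "\<rho> i \<noteq> 1" using freq_neq_1[OF x(2,3)] by (simp add: \<rho>_def x(1))
  qed
  moreover have "(\<lambda>N. (\<Sum>n<N. \<Sum>\<^sub>\<infinity>i\<in>I. a i * \<rho> i ^ n) / of_nat N) \<longlonglongrightarrow> W"
  proof (rule tendsto_eventually)
    \<comment> \<open>Equality holds only eventually: at \<open>N = 0\<close> the mean is a division
      by zero, hence 0.\<close>
    show "\<forall>\<^sub>F N in sequentially. (\<Sum>n<N. \<Sum>\<^sub>\<infinity>i\<in>I. a i * \<rho> i ^ n) / of_nat N = W"
      using eventually_gt_at_top[of 0] by eventually_elim (simp add: W[symmetric])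
  qed
  ultimately have "W = a ([], [])" by (rule LIMSEQ_unique[rotated])
  then show ?thesis by (simp add: a_def cp_def cm_def)
qed

end

section \<open>The two inclusions for the spectrum\<close>

lemma constant_on_int:
  fixes f :: "int \<Rightarrow> 'a"
  assumes "\<And>n. f n = f (n - 1)"
  shows "f n = f 0"
proof (induction n rule: int_induct[where k = 0])
  case (step1 i)
  then show ?case using assms[of "i + 1"] by simp
next
  case (step2 i)
  then show ?case using assms[of i] by simp
qed simp

lemma finite_support_ell2:
  assumes K: "finite K" and \<psi>: "\<And>n. n \<notin> K \<Longrightarrow> \<psi> n = 0"
  shows "\<psi> \<in> ell2" and "ell2_norm \<psi> = L2_set (\<lambda>n. cmod (\<psi> n)) K"
proof -
  have "((\<lambda>n. (cmod (\<psi> n))\<^sup>2) has_sum (\<Sum>n\<in>K. (cmod (\<psi> n))\<^sup>2)) K"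
    by (rule has_sum_finite[OF K])
  then have "((\<lambda>n. (cmod (\<psi> n))\<^sup>2) has_sum (\<Sum>n\<in>K. (cmod (\<psi> n))\<^sup>2)) UNIV"
    by (rule iffD1[OF has_sum_cong_neutral, rotated -1]) (auto simp: \<psi>)
  then show "\<psi> \<in> ell2" and "ell2_norm \<psi> = L2_set (\<lambda>n. cmod (\<psi> n)) K"
    by (auto simp: ell2_def ell2_norm_def L2_set_def has_sum_iff)
qed

context one_sided
begin

text \<open>The bounds on the two waves hold on the whole lattice and not only near the end where
  each decays. Hence their product at \<open>n\<close> and \<open>m\<close> is controlled by
  \<open>n - m\<close> alone, which is the convolution majorant needed for the Green kernel.\<close>

lemma not_in_spectrum_off_interval:
  assumes "E \<notin> complex_of_real ` {-2..2}"
  shows "E \<notin> spectrum H"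
proof -
  obtain z where z: "z \<noteq> 0" "cmod z < 1" and E: "E = z + inverse z"
    by (rule exists_joukowski_preimage[OF assms])
  have zsq: "cmod (z\<^sup>2) < 1" using z by (simp add: norm_power power_less_one_iff)
  have a1: "apart \<kappa> 1" using B_pos \<beta>_bounds \<kappa>_pos by (rule apart_1)
  have a2: "apart \<kappa> (z\<^sup>2)" using zsq \<kappa>_pos by (intro apart_off_circle) auto
  have a3: "apart \<kappa> (inverse (z\<^sup>2))" using zsq \<kappa>_pos by (intro apart_off_circle) (auto simp: norm_inverse)
  have iz: "inverse z \<noteq> 0" using z by simp
  define p where "p = wave S g w (symb z z) z"
  define q where "q = wave S g w (symb (inverse z) z) (inverse z)"
  define Cp where "Cp = (\<Sum>\<^sub>\<infinity>ks\<in>lists S. cmod (wcoef g w (symb z z) ks))"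
  define Cq where "Cq = (\<Sum>\<^sub>\<infinity>ks\<in>lists S. cmod (wcoef g w (symb (inverse z) z) ks))"
  note P = wave_solves[OF a1 a3 z(1) symb_lower_bound[OF z]]
  note Q = wave_solves[OF a1 a2 iz symb_inverse_lower_bound[OF z]]
  have p: "p (n + 1) = E * p n - V n * p n - p (n - 1)" for n
    using P(2)[of n] by (simp add: p_def H_def E symb_1 algebra_simps)
  have q: "q (n + 1) = E * q n - V n * q n - q (n - 1)" for n
    using Q(2)[of n] by (simp add: q_def H_def E symb_1 algebra_simps)
  have C0: "0 \<le> Cp" "0 \<le> Cq" unfolding Cp_def Cq_def by (auto intro!: infsum_nonneg)
  have pb: "cmod (p n) \<le> Cp * cmod z powi n" for n
    unfolding p_def Cp_def by (rule norm_wave_le[OF P(1)])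
  have qb: "cmod (q n) \<le> Cq * inverse (cmod z) powi n" for n
    unfolding q_def Cq_def using norm_wave_le[OF Q(1), of "inverse z" n] by (simp only: norm_inverse)
  define W where "W = p 1 * q 0 - p 0 * q 1"
  have wr: "p (n + 1) * q n - p n * q (n + 1) = W" for n
  proof -
    define f where "f n = p (n + 1) * q n - p n * q (n + 1)" for n
    have "f n = f (n - 1)" for n unfolding f_def by (simp only: p[of n] q[of n] diff_add_cancel) (simp add: algebra_simps)
    then have "f n = f 0" by (rule constant_on_int)
    then show ?thesis by (simp add: f_def W_def)
  qed
  have "W = z - inverse z"
    by (rule wronskian_waves[OF z P(1) Q(1)], assumption, assumption, rule wr[unfolded p_def q_def])
  moreover have "z \<noteq> inverse z"
  proof
    assume "z = inverse z"
    then have "z\<^sup>2 = 1" using z by (metis power2_eq_square right_inverse)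
    then show False using zsq by simp
  qed
  ultimately have W: "W \<noteq> 0" by simp
  define G where "G n m = (if m \<le> n then p n * q m else p m * q n) / W" for n m
  define \<gamma> where "\<gamma> j = (Cp * Cq / cmod W) * cmod z ^ nat \<bar>j\<bar>" for j :: int
  have "E \<notin> spectrum (\<lambda>\<psi> n. \<psi> (n + 1) + \<psi> (n - 1) + V n * \<psi> n)"
  proof (rule not_in_spectrum_green[where G = G and \<gamma> = \<gamma>])
    show "cmod (V n) \<le> (\<Sum>\<^sub>\<infinity>k\<in>S. cmod (g k))" for n by (rule norm_V_le)
    show "\<gamma> summable_on UNIV" unfolding \<gamma>_def
      using z by (intro summable_on_cmult_right summable_power_abs_int) auto
    show sym: "G n m = G m n" for n m by (auto simp: G_def mult.commute)
    have *: "cmod (G n m) \<le> \<gamma> (n - m)" if "m \<le> n" for n m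
    proof -
      have "cmod (p n * q m) \<le> (Cp * cmod z powi n) * (Cq * inverse (cmod z) powi m)"
        unfolding norm_mult using C0 by (intro mult_mono pb qb) auto
      also have "\<dots> = Cp * Cq * cmod z powi (n - m)"
        using z by (simp add: power_int_diff power_int_inverse divide_inverse)
      also have "cmod z powi (n - m) = cmod z ^ nat \<bar>n - m\<bar>"
        using that by (simp add: power_int_def)
      finally show ?thesis using that W
        by (simp add: G_def \<gamma>_def norm_divide divide_right_mono)
    qed
    show "cmod (G n m) \<le> \<gamma> (n - m)" for n m
    proof (cases "m \<le> n")
      case False
      then have "cmod (G m n) \<le> \<gamma> (m - n)" by (intro *) simp
      then show ?thesis using sym[of n m] by (simp add: \<gamma>_def abs_minus_commute)
    qed (rule *)
    show "G (n + 1) m + G (n - 1) m + V n * G n m - E * G n m = of_bool (n = m)" for n m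
    proof -
      consider "n = m" | "m < n" | "n < m" by linarith
      then show ?thesis
      proof cases
        case 1
        have "p (m + 1) * q m + p m * q (m - 1) + V m * (p m * q m) - E * (p m * q m) = W"
          unfolding wr[of m, symmetric] q[of m] by (simp add: algebra_simps)
        then have "(p (m + 1) * q m + p m * q (m - 1) + V m * (p m * q m) - E * (p m * q m)) / W = 1"
          using W by simp
        then show ?thesis using 1 by (simp add: G_def add_divide_distrib diff_divide_distrib)
      next
        case 2
        then have "m \<le> n + 1" "m \<le> n - 1" "m \<le> n" by auto
        moreover have "p (n + 1) * q m + p (n - 1) * q m + V n * (p n * q m) - E * (p n * q m) = 0"
          unfolding p[of n] by (simp add: algebra_simps)
        then have "(p (n + 1) * q m + p (n - 1) * q m + V n * (p n * q m) - E * (p n * q m)) / W = 0"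
          by simp
        ultimately show ?thesis using 2 by (simp add: G_def add_divide_distrib diff_divide_distrib)
      next
        case 3
        \<comment> \<open>The two branches of \<open>G\<close> agree on the diagonal, so this
          formula also covers \<open>n + 1 = m\<close>.\<close>
        have G: "G i m = p m * q i / W" if "i \<le> m" for i
          using that by (cases "i = m") (auto simp: G_def)
        have "p m * q (n + 1) + p m * q (n - 1) + V n * (p m * q n) - E * (p m * q n) = 0"
          unfolding q[of n] by (simp add: algebra_simps)
        then have "(p m * q (n + 1) + p m * q (n - 1) + V n * (p m * q n) - E * (p m * q n)) / W = 0"
          by simp
        then show ?thesis using 3 by (simp add: G add_divide_distrib diff_divide_distrib)
      qed
    qed
  qed
  then show ?thesis unfolding H_def .
qed

text \<open>Near an energy \<open>x = 2 cos \<theta>\<close> of the free operator, a bounded inverse of \<open>H - x\<close> would bound the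
  mean square of the solution of \<open>(H - x - i\<delta>) \<psi> = e\<^sup>i\<^sup>n\<^sup>\<theta>\<close>, normalised to have right-hand side
  \<open>- i\<delta> e\<^sup>i\<^sup>n\<^sup>\<theta>\<close>, by less than the modulus of its mode at \<open>\<theta>\<close>, which is 1.\<close>

lemma in_spectrum_on_interval:
  assumes x: "x \<in> {-2..2}"
  shows "complex_of_real x \<in> spectrum H"
proof (rule ccontr)
  assume "complex_of_real x \<notin> spectrum H"
  then obtain R where R: "bounded_operator R"
    and RH: "\<And>\<psi>. \<psi> \<in> ell2 \<Longrightarrow> R (\<lambda>n. H \<psi> n - complex_of_real x * \<psi> n) = \<psi>"
    unfolding spectrum_def by blast
  obtain A0 where A0: "\<And>\<psi>. \<psi> \<in> ell2 \<Longrightarrow> ell2_norm (R \<psi>) \<le> A0 * ell2_norm \<psi>"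
    using R unfolding bounded_operator_def by blast
  define A where "A = max A0 1"
  have A: "1 \<le> A" "ell2_norm (R \<psi>) \<le> A * ell2_norm \<psi>" if "\<psi> \<in> ell2" for \<psi>
    using order_trans[OF A0[OF that] mult_right_mono[OF max.cobounded1[of A0 1] ell2_norm_nonneg]]
    by (auto simp: A_def)
  have A1: "1 \<le> A" by (simp add: A_def)
  \<comment> \<open>With \<open>A * \<delta> = 1 / 4\<close> the inequality for \<open>N\<close>
    below can be solved to \<open>N \<le> sqrt (real m) / 3 + c1\<close>, and 1/3 is less than the
    modulus 1 of the leading mode.\<close>
  define \<delta> where "\<delta> = 1 / (4 * A)"
  have \<delta>: "0 < \<delta>" "A * \<delta> = 1 / 4" using A1 by (auto simp: \<delta>_def)
  define E where "E = complex_of_real x + \<i> * complex_of_real \<delta>"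
  have "Im E = \<delta>" by (simp add: E_def)
  then have "E \<notin> complex_of_real ` {-2..2}" using \<delta> by auto
  then obtain z where z: "z \<noteq> 0" "cmod z < 1" and Ez: "E = z + inverse z"
    by (rule exists_joukowski_preimage)
  define t where "t = cis (arccos (x / 2))"
  have t1: "cmod t = 1" by (simp add: t_def)
  have t0: "t \<noteq> 0" using t1 by auto
  have tx: "t + inverse t = complex_of_real x"
    using x by (simp add: t_def complex_eq_iff cos_arccos)
  \<comment> \<open>Since \<open>z\<close> is inside the disc and \<open>t\<close> on the circle,
    both zeros are off the circle; for \<delta> = 0 they would lie on it.\<close>
  have a1: "apart \<kappa> (z / t)" using z t1 \<kappa>_pos by (intro apart_off_circle) (auto simp: norm_divide)
  have a2: "apart \<kappa> (inverse (z * t))"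
    using z t1 \<kappa>_pos by (intro apart_off_circle) (auto simp: norm_inverse norm_mult)
  define c where "c = wcoef g w (symb t z)"
  define \<psi> where "\<psi> = wave S g w (symb t z) t"
  note sol = wave_solves[OF a1 a2 t0 symb_circle_lower_bound[OF z(1) t1]]
  define C where "C = (\<Sum>\<^sub>\<infinity>ks\<in>lists S. cmod (c ks))"
  have C: "cmod (\<psi> n) \<le> C" for n
    using norm_wave_le[OF sol(1), of t n] t1 by (simp add: \<psi>_def C_def c_def)
  have C0: "0 \<le> C" using order_trans[OF norm_ge_zero C[of 0]] .
  have eq: "\<psi> (n + 1) + \<psi> (n - 1) + V n * \<psi> n - complex_of_real x * \<psi> n
      = \<i> * complex_of_real \<delta> * (\<psi> n - t powi n)" for n
  proof -
    \<comment> \<open>\<open>t\<close> solves the free equation at the energy \<open>x\<close>, so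
      the defect of the plane wave is \<open>x - E\<close>.\<close>
    have "symb t z 1 = - (\<i> * complex_of_real \<delta>)"
      by (simp add: symb_def Ez[symmetric] E_def tx)
    then show ?thesis using sol(2)[of n]
      by (simp add: H_def \<psi>_def[symmetric] Ez[symmetric] E_def algebra_simps)
  qed
  \<comment> \<open>\<open>8 * (A * C)\<close> from the cut-off errors, divided by
    \<open>1 - 1 / 4\<close>.\<close>
  define c1 where "c1 = 32 / 3 * (A * C)"
  have mean_le: "cmod ((\<Sum>n<m. \<psi> (int n) * inverse t ^ n) / of_nat m) \<le> 1 / 3 + c1 * inverse (sqrt (real m))"
    if m: "0 < m" for m :: nat
  proof -
    \<comment> \<open>The wave is bounded but need not be square summable, so it is cut off. The
      resulting error \<open>e\<close> lives on at most four sites next to the ends, independently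
      of \<open>m\<close>.\<close>
    define \<phi> where "\<phi> n = (if 0 \<le> n \<and> n < int m then \<psi> n else 0)" for n
    define u where "u n = H \<phi> n - complex_of_real x * \<phi> n" for n
    define b where "b n = (if 0 \<le> n \<and> n < int m then \<i> * complex_of_real \<delta> * t powi n else 0)" for n
    define e where "e n = u n - (\<i> * complex_of_real \<delta> * \<phi> n - b n)" for n
    define K where "K = {-1..int m}"
    have K: "finite K" by (simp add: K_def)
    have \<phi>K: "\<phi> n = 0" if "n \<notin> K" for n using that by (auto simp: \<phi>_def K_def)
    have uK: "u n = 0" if "n \<notin> K" for n using that by (auto simp: u_def H_def \<phi>_def K_def)
    define J where "J = {-1, 0, int m - 1, int m}"
    have eJ: "e n = 0" if "n \<notin> J" for n
    proof (cases "0 \<le> n \<and> n < int m")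
      case True
      then have "0 < n" "n < int m - 1" using that by (auto simp: J_def)
      then show ?thesis using eq[of n]
        by (simp add: e_def u_def H_def \<phi>_def b_def algebra_simps)
    next
      case False
      then have "n < - 1 \<or> int m < n" using that by (auto simp: J_def)
      then show ?thesis by (auto simp: e_def u_def H_def \<phi>_def b_def)
    qed
    have eC: "cmod (e n) \<le> 2 * C" for n
    proof (cases "0 \<le> n \<and> n < int m")
      case True
      then have "e n = (\<phi> (n + 1) - \<psi> (n + 1)) + (\<phi> (n - 1) - \<psi> (n - 1))" using eq[of n]
        by (simp add: e_def u_def H_def b_def \<phi>_def[of n] algebra_simps)
      also have "cmod \<dots> \<le> cmod (\<phi> (n + 1) - \<psi> (n + 1)) + cmod (\<phi> (n - 1) - \<psi> (n - 1))"
        by (rule norm_triangle_ineq)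
      also have "\<dots> \<le> C + C" using C C0 by (intro add_mono) (auto simp: \<phi>_def)
      finally show ?thesis by simp
    next
      case False
      then have "e n = \<phi> (n + 1) + \<phi> (n - 1)"
        by (auto simp: e_def u_def H_def b_def \<phi>_def[of n])
      also have "cmod \<dots> \<le> cmod (\<phi> (n + 1)) + cmod (\<phi> (n - 1))"
        by (rule norm_triangle_ineq)
      also have "\<dots> \<le> C + C" using C C0 by (intro add_mono) (auto simp: \<phi>_def)
      finally show ?thesis by simp
    qed
    have "(\<Sum>n\<in>K. cmod (e n)) \<le> (\<Sum>n\<in>J. cmod (e n))"
    proof -
      have "(\<Sum>n\<in>K. cmod (e n)) \<le> (\<Sum>n\<in>K \<union> J. cmod (e n))"
        using K by (intro sum_mono2) (auto simp: J_def)
      also have "\<dots> = (\<Sum>n\<in>J. cmod (e n))"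
        using K by (intro sum.mono_neutral_right) (auto simp: eJ J_def)
      finally show ?thesis .
    qed
    also have "\<dots> \<le> (\<Sum>n\<in>J. 2 * C)" by (intro sum_mono eC)
    also have "\<dots> = real (card J) * (2 * C)" by simp
    also have "\<dots> \<le> 4 * (2 * C)"
      using C0 by (intro mult_right_mono) (auto simp: J_def card_insert_if)
    finally have e_sum: "(\<Sum>n\<in>K. cmod (e n)) \<le> 8 * C" by simp
    have bK: "L2_set (\<lambda>n. cmod (b n)) K = \<delta> * sqrt (real m)"
    proof -
      have "(\<Sum>n\<in>K. (cmod (b n))\<^sup>2) = (\<Sum>n\<in>{0..<int m}. \<delta>\<^sup>2)"
        by (rule sum.mono_neutral_cong_right[OF K])
          (use \<delta> in \<open>auto simp: K_def b_def norm_mult norm_power_int t1\<close>)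
      then show ?thesis using \<delta> by (simp add: L2_set_def real_sqrt_mult)
    qed
    define N where "N = ell2_norm \<phi>"
    have N: "N = L2_set (\<lambda>n. cmod (\<phi> n)) K" and \<phi>2: "\<phi> \<in> ell2"
      unfolding N_def using finite_support_ell2[OF K \<phi>K] by auto
    have u2: "u \<in> ell2" "ell2_norm u = L2_set (\<lambda>n. cmod (u n)) K"
      using finite_support_ell2[OF K uK] by auto
    have "L2_set (\<lambda>n. cmod (u n)) K \<le> L2_set (\<lambda>n. (\<delta> * cmod (\<phi> n) + cmod (b n)) + cmod (e n)) K"
    proof (rule L2_set_mono)
      fix n
      have "u n = (\<i> * complex_of_real \<delta> * \<phi> n - b n) + e n" by (simp add: e_def)
      then have "cmod (u n) \<le> cmod (\<i> * complex_of_real \<delta> * \<phi> n) + cmod (b n) + cmod (e n)"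
        by (metis add_mono_thms_linordered_semiring(3) norm_triangle_ineq norm_triangle_ineq4 order_trans)
      then show "cmod (u n) \<le> (\<delta> * cmod (\<phi> n) + cmod (b n)) + cmod (e n)"
        using \<delta> by (simp add: norm_mult)
    qed simp
    also have "\<dots> \<le> L2_set (\<lambda>n. \<delta> * cmod (\<phi> n) + cmod (b n)) K + L2_set (\<lambda>n. cmod (e n)) K"
      by (rule L2_set_triangle_ineq)
    also have "L2_set (\<lambda>n. \<delta> * cmod (\<phi> n) + cmod (b n)) K \<le> L2_set (\<lambda>n. \<delta> * cmod (\<phi> n)) K + L2_set (\<lambda>n. cmod (b n)) K"
      by (rule L2_set_triangle_ineq)
    also have "L2_set (\<lambda>n. \<delta> * cmod (\<phi> n)) K = \<delta> * N"
      unfolding N using \<delta> by (intro L2_set_right_distrib[symmetric]) simp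
    also have "L2_set (\<lambda>n. cmod (e n)) K \<le> (\<Sum>n\<in>K. cmod (e n))" by (rule L2_set_le_sum) simp
    finally have unorm: "ell2_norm u \<le> \<delta> * N + \<delta> * sqrt (real m) + 8 * C"
      using e_sum unfolding bK u2(2) by linarith
    have "R u = \<phi>" unfolding u_def by (rule RH[OF \<phi>2])
    then have "N \<le> A * ell2_norm u" using A(2)[OF u2(1)] by (simp add: N_def)
    also have "\<dots> \<le> A * (\<delta> * N + \<delta> * sqrt (real m) + 8 * C)"
      using unorm A1 by (intro mult_left_mono) auto
    also have "\<dots> = (A * \<delta>) * N + (A * \<delta>) * sqrt (real m) + 8 * (A * C)"
      by (simp add: algebra_simps)
    finally have Nle: "N \<le> sqrt (real m) / 3 + c1"
      unfolding \<delta>(2) c1_def by (simp add: field_simps)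
    have "cmod (\<Sum>n<m. \<psi> (int n) * inverse t ^ n) \<le> (\<Sum>n<m. cmod (\<psi> (int n)))"
      by (rule order_trans[OF norm_sum]) (simp add: norm_mult norm_power norm_inverse t1)
    also have "\<dots> = (\<Sum>n\<in>{0..<int m}. \<bar>cmod (\<phi> n)\<bar> * \<bar>1\<bar>)"
      by (rule sum.reindex_bij_witness[where i = nat and j = int]) (auto simp: \<phi>_def)
    also have "\<dots> \<le> L2_set (\<lambda>n. cmod (\<phi> n)) {0..<int m} * L2_set (\<lambda>n. 1) {0..<int m}"
      by (rule L2_set_mult_ineq)
    also have "L2_set (\<lambda>n. cmod (\<phi> n)) {0..<int m} = N"
      unfolding N L2_set_def
      by (intro arg_cong[where f = sqrt] sum.mono_neutral_left[OF K]) (auto simp: K_def \<phi>_def)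
    also have "L2_set (\<lambda>n. 1 :: real) {0..<int m} = sqrt (real m)" by (simp add: L2_set_def)
    also have "N * sqrt (real m) \<le> (sqrt (real m) / 3 + c1) * sqrt (real m)"
      using Nle by (intro mult_right_mono) auto
    finally have "cmod (\<Sum>n<m. \<psi> (int n) * inverse t ^ n) \<le> (sqrt (real m) / 3 + c1) * sqrt (real m)" .
    then have "cmod (\<Sum>n<m. \<psi> (int n) * inverse t ^ n) / real m \<le> (sqrt (real m) / 3 + c1) * sqrt (real m) / real m"
      by (rule divide_right_mono) simp
    also have "\<dots> = 1 / 3 + c1 * inverse (sqrt (real m))"
    proof -
      have "real m = sqrt (real m) * sqrt (real m)" by simp
      then have "(sqrt (real m) / 3 + c1) * sqrt (real m) / real m
          = (sqrt (real m) / 3 + c1) * sqrt (real m) / (sqrt (real m) * sqrt (real m))" by simp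
      also have "\<dots> = 1 / 3 + c1 * inverse (sqrt (real m))"
        using m by (simp add: field_simps del: real_sqrt_mult_self)
      finally show ?thesis .
    qed
    finally show ?thesis by (simp add: norm_divide)
  qed
  \<comment> \<open>Removing the factor \<open>t ^ n\<close> turns the leading mode into the
    constant one, whose coefficient \<open>c []\<close> is 1.\<close>
  have "(\<lambda>m. (\<Sum>n<m. \<Sum>\<^sub>\<infinity>ks\<in>lists S. c ks * freq w ks ^ n) / of_nat m) \<longlonglongrightarrow> c []"
    by (rule mean_of_exponential_sum_tendsto)
      (use sol(1) norm_freq freq_neq_1 in \<open>auto simp: c_def\<close>)
  also have "(\<lambda>m. (\<Sum>n<m. \<Sum>\<^sub>\<infinity>ks\<in>lists S. c ks * freq w ks ^ n) / of_nat m)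
      = (\<lambda>m. (\<Sum>n<m. \<psi> (int n) * inverse t ^ n) / of_nat m)"
  proof -
    have "(\<Sum>\<^sub>\<infinity>ks\<in>lists S. c ks * freq w ks ^ n) = \<psi> (int n) * inverse t ^ n" for n
    proof -
      have "\<psi> (int n) = (\<Sum>\<^sub>\<infinity>ks\<in>lists S. t ^ n * (c ks * freq w ks ^ n))"
        by (simp add: \<psi>_def wave_def c_def[symmetric] power_mult_distrib mult.left_commute)
      then have "\<psi> (int n) = t ^ n * (\<Sum>\<^sub>\<infinity>ks\<in>lists S. c ks * freq w ks ^ n)"
        by (simp add: infsum_cmult_right')
      then show ?thesis using t0 by (simp add: power_inverse)
    qed
    then show ?thesis by simp
  qed
  finally have lim1: "(\<lambda>m. cmod ((\<Sum>n<m. \<psi> (int n) * inverse t ^ n) / of_nat m)) \<longlonglongrightarrow> cmod (c [])"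
    by (rule tendsto_norm)
  have lim2: "(\<lambda>m. 1 / 3 + c1 * inverse (sqrt (real m))) \<longlonglongrightarrow> 1 / 3 + c1 * 0"
    by (intro tendsto_add tendsto_mult tendsto_const tendsto_inverse_0_at_top
        filterlim_compose[OF sqrt_at_top] filterlim_real_sequentially)
  have "\<forall>\<^sub>F m in sequentially. cmod ((\<Sum>n<m. \<psi> (int n) * inverse t ^ n) / of_nat m)
      \<le> 1 / 3 + c1 * inverse (sqrt (real m))"
    using eventually_gt_at_top[of 0] by eventually_elim (rule mean_le)
  from tendsto_le[OF sequentially_bot lim2 lim1 this] have "cmod (c []) \<le> 1 / 3 + c1 * 0" .
  then show False by (simp add: c_def)
qed

lemma spectrum_H: "spectrum H = complex_of_real ` {-2..2}"
  using not_in_spectrum_off_interval in_spectrum_on_interval by blast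

end

subsection \<open>Diophantine frequencies and the cone\<close>

text \<open>The chord is \<open>2 * \<bar>sin (x / 2)\<bar>\<close>, and for
  \<open>\<bar>x / 2\<bar> \<le> 2\<close> the cubic remainder removes at most 4/6 of the linear
  term.\<close>

lemma abs_le_3_norm_cis_minus_1:
  assumes "\<bar>x\<bar> \<le> pi"
  shows "\<bar>x\<bar> \<le> 3 * cmod (cis x - 1)"
proof -
  define y where "y = x / 2"
  have y: "\<bar>y\<bar> \<le> 2" using assms pi_half_less_two by (simp add: y_def)
  have "\<bar>sin y - (\<Sum>m<3. sin_coeff m * y ^ m)\<bar> \<le> inverse (fact 3) * \<bar>y\<bar> ^ 3"
    by (rule Maclaurin_sin_bound)
  moreover have "(\<Sum>m<3. sin_coeff m * y ^ m) = y"
    by (simp add: numeral_3_eq_3 sin_coeff_def)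
  moreover have "inverse (fact 3) * \<bar>y\<bar> ^ 3 \<le> (2 / 3) * \<bar>y\<bar>"
  proof -
    have "y\<^sup>2 \<le> 4" using power_mono[OF y, of 2] by simp
    then have "\<bar>y\<bar> * y\<^sup>2 \<le> \<bar>y\<bar> * 4" by (intro mult_left_mono) auto
    then show ?thesis by (simp add: fact_numeral power3_eq_cube power2_eq_square[of y] mult.assoc)
  qed
  ultimately have "\<bar>y\<bar> / 3 \<le> \<bar>sin y\<bar>" by linarith
  moreover have "cmod (cis x - 1) = 2 * \<bar>sin y\<bar>"
    unfolding cis_conv_exp y_def by (rule dist_exp_i_1)
  ultimately show ?thesis by (simp add: y_def)
qed

lemma INF_dist_2pi_le:
  "(INF n::int. \<bar>x - 2 * pi * real_of_int n\<bar>) \<le> 3 * cmod (cis x - 1)"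
proof -
  define n where "n = round (x / (2 * pi))"
  define y where "y = x - 2 * pi * real_of_int n"
  have "\<bar>real_of_int n - x / (2 * pi)\<bar> \<le> 1 / 2" unfolding n_def by (rule of_int_round_abs_le)
  then have "(2 * pi) * \<bar>real_of_int n - x / (2 * pi)\<bar> \<le> (2 * pi) * (1 / 2)"
    by (intro mult_left_mono) auto
  also have "(2 * pi) * \<bar>real_of_int n - x / (2 * pi)\<bar> = \<bar>(2 * pi) * (real_of_int n - x / (2 * pi))\<bar>"
    by (simp add: abs_mult)
  also have "(2 * pi) * (real_of_int n - x / (2 * pi)) = - y" by (simp add: y_def algebra_simps)
  finally have "\<bar>y\<bar> \<le> pi" by simp
  then have "\<bar>y\<bar> \<le> 3 * cmod (cis y - 1)" by (rule abs_le_3_norm_cis_minus_1)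
  also have "cis y = cis x" unfolding y_def by (simp add: cis_divide[symmetric] cis_multiple_2pi)
  finally have "\<bar>y\<bar> \<le> 3 * cmod (cis x - 1)" .
  moreover have "(INF n::int. \<bar>x - 2 * pi * real_of_int n\<bar>) \<le> \<bar>y\<bar>"
    unfolding y_def by (rule cINF_lower) (auto intro: bdd_belowI[where m = 0])
  ultimately show ?thesis by simp
qed

lemma infsum_finite_support:
  fixes f :: "'a \<Rightarrow> 'b :: {topological_comm_monoid_add, t2_space}"
  assumes "finite A" "\<And>j. j \<notin> A \<Longrightarrow> f j = 0"
  shows "(\<Sum>\<^sub>\<infinity>j. f j) = (\<Sum>j\<in>A. f j)"
proof -
  have "(\<Sum>\<^sub>\<infinity>j. f j) = (\<Sum>\<^sub>\<infinity>j\<in>A. f j)"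
    by (rule infsum_cong_neutral) (use assms in auto)
  then show ?thesis using assms by simp
qed

lemma jap_ge_1: "1 \<le> jap j" by (simp add: jap_def)

lemma eta_term_ge_1:
  assumes "0 < \<eta>" "k j \<noteq> 0"
  shows "1 \<le> jap j powr \<eta> * \<bar>real_of_int (k j)\<bar>"
proof -
  have "1 \<le> \<bar>real_of_int (k j)\<bar>" using assms(2) by linarith
  moreover have "1 \<le> jap j powr \<eta>" using jap_ge_1 assms(1) by (intro ge_one_powr_ge_zero) auto
  ultimately show ?thesis using mult_mono[of 1 "jap j powr \<eta>" 1 "\<bar>real_of_int (k j)\<bar>"] by simp
qed

lemma finite_support_Zstar:
  assumes \<eta>: "0 < \<eta>" and k: "k \<in> Zstar d \<eta>"
  shows "finite {j. k j \<noteq> 0}"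
proof (rule ccontr)
  assume inf: "infinite {j. k j \<noteq> 0}"
  define f where "f j = jap j powr \<eta> * \<bar>real_of_int (k j)\<bar>" for j
  have f: "f summable_on UNIV" using k by (simp add: Zstar_def f_def[abs_def])
  obtain M :: nat where M: "infsum f UNIV < real M" using reals_Archimedean2 by blast
  obtain F where F: "finite F" "card F = M" "F \<subseteq> {j. k j \<noteq> 0}"
    using infinite_arbitrarily_large[OF inf] by blast
  have "real M = (\<Sum>j\<in>F. 1)" using F by simp
  also have "\<dots> \<le> (\<Sum>j\<in>F. f j)" unfolding f_def using F eta_term_ge_1[OF \<eta>] by (intro sum_mono) auto
  also have "\<dots> \<le> infsum f UNIV"
    by (rule finite_sum_le_infsum[OF f F(1)]) (auto simp: f_def)
  finally show False using M by simp
qed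

lemma eta_norm_finite:
  assumes "finite A" "{j. k j \<noteq> 0} \<subseteq> A"
  shows "eta_norm \<eta> k = (\<Sum>j\<in>A. jap j powr \<eta> * \<bar>real_of_int (k j)\<bar>)"
  unfolding eta_norm_def using assms by (intro infsum_finite_support) auto

lemma pairing_finite:
  fixes x :: "nat \<Rightarrow> 'a :: real_normed_field"
  assumes "finite A" "{j. k j \<noteq> 0} \<subseteq> A"
  shows "pairing k x = (\<Sum>j\<in>A. of_int (k j) * x j)"
  unfolding pairing_def using assms by (intro infsum_finite_support) auto

lemma eta_norm_ge_1:
  assumes "0 < \<eta>" "finite {j. k j \<noteq> 0}" "k j \<noteq> 0"
  shows "1 \<le> eta_norm \<eta> k"
proof -
  have "1 \<le> jap j powr \<eta> * \<bar>real_of_int (k j)\<bar>" using assms by (intro eta_term_ge_1)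
  also have "\<dots> \<le> eta_norm \<eta> k"
    unfolding eta_norm_finite[OF assms(2) subset_refl] using assms by (intro member_le_sum) auto
  finally show ?thesis .
qed

lemma eta_norm_Zstar_ge_1:
  assumes "0 < \<eta>" "k \<in> Zstar d \<eta>"
  shows "1 \<le> eta_norm \<eta> k"
proof -
  have "\<exists>j. k j \<noteq> 0"
  proof (rule ccontr)
    assume "\<not> ?thesis"
    then have "eta_norm \<eta> k = 0" by (simp add: eta_norm_def)
    then show False using assms by (simp add: Zstar_def)
  qed
  then show ?thesis using eta_norm_ge_1[OF assms(1) finite_support_Zstar[OF assms]] by blast
qed

text \<open>The bound on the small divisors that makes the case \<open>d = \<infinity>\<close> work. Put
  \<open>a j = jap j powr \<eta> * \<bar>k j\<bar>\<close>, so \<open>M = \<Sum>j. a j\<close>. Each factor is at most \<open>exp (c * a j powr (1/4))\<close>;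
  coordinates with \<open>j \<le> sqrt M\<close> contribute at most \<open>sqrt M * M powr (1/4)\<close> to the exponent, for the
  others \<open>a j powr (1/4) \<le> a j * (sqrt M) powr (- 3 * \<eta> / 4)\<close>.\<close>

lemma diophantine_product_bound:
  fixes \<eta> \<tau> :: real
  assumes \<eta>: "0 < \<eta>" and \<tau>: "0 < \<tau>"
  obtains c \<beta> where "0 < c" "0 < \<beta>" "\<beta> < 1"
    "\<And>d k. k \<in> Zstar d \<eta> \<Longrightarrow> exp (- (c * eta_norm \<eta> k powr \<beta>))
        \<le> (\<Prod>j | k j \<noteq> 0. 1 / (1 + jap j powr \<tau> * \<bar>real_of_int (k j)\<bar> powr \<tau>))"
proof -
  \<comment> \<open>One exponent for both parts of \<open>a j\<close>:
    \<open>jap j powr \<eta>\<close> needs at least \<open>\<tau> / \<eta>\<close>, and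
    \<open>\<bar>k j\<bar>\<close> needs \<open>\<tau>\<close>.\<close>
  define \<sigma> where "\<sigma> = \<tau> + \<tau> / \<eta>"
  \<comment> \<open>The 1 comes from bounding 2 by \<open>exp 1\<close>, the 4 from
    \<open>ln a \<le> 4 * a powr (1/4)\<close>.\<close>
  define c0 where "c0 = 1 + 4 * \<sigma>"
  \<comment> \<open>The exponent \<open>1/2 + 1/4\<close> belongs to the small coordinates,
    \<open>1 - 3 * \<eta> / 8\<close> to the large ones.\<close>
  define \<beta> where "\<beta> = max (3/4) (1 - 3 * \<eta> / 8)"
  have \<sigma>: "0 < \<sigma>" "\<tau> \<le> \<sigma>" "\<tau> / \<eta> \<le> \<sigma>" using \<eta> \<tau> by (auto simp: \<sigma>_def add_pos_pos)
  have c0: "0 < c0" using \<sigma> by (simp add: c0_def)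
  have \<beta>: "0 < \<beta>" "\<beta> < 1" using \<eta> by (auto simp: \<beta>_def less_max_iff_disj)
  show ?thesis
  proof (rule that[of "2 * c0" \<beta>])
    fix d k assume k: "k \<in> Zstar d \<eta>"
    define A where "A = {j. k j \<noteq> 0}"
    define a where "a j = jap j powr \<eta> * \<bar>real_of_int (k j)\<bar>" for j
    define M where "M = eta_norm \<eta> k"
    have A: "finite A" unfolding A_def by (rule finite_support_Zstar[OF \<eta> k])
    have M: "M = (\<Sum>j\<in>A. a j)" unfolding M_def a_def using A by (intro eta_norm_finite) (auto simp: A_def)
    have M1: "1 \<le> M" unfolding M_def by (rule eta_norm_Zstar_ge_1[OF \<eta> k])
    \<comment> \<open>Index 0 is no coordinate, so at most \<open>sqrt M\<close> coordinates satisfy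
      \<open>j \<le> sqrt M\<close>.\<close>
    have j1: "1 \<le> j" if "j \<in> A" for j
      using k that by (cases j) (auto simp: A_def Zstar_def tuples_def indices_def)
    have a1: "1 \<le> a j" if "j \<in> A" for j
      using that unfolding a_def A_def by (intro eta_term_ge_1 \<eta>) auto
    have aM: "a j \<le> M" if "j \<in> A" for j
      unfolding M using that A by (intro member_le_sum) (auto simp: a_def)
    have factor: "exp (- (c0 * a j powr (1/4))) \<le> 1 / (1 + jap j powr \<tau> * \<bar>real_of_int (k j)\<bar> powr \<tau>)"
      if j: "j \<in> A" for j
    proof -
      have n1: "1 \<le> \<bar>real_of_int (k j)\<bar>"
      proof -
        have "k j \<noteq> 0" using j by (simp add: A_def)
        then show ?thesis by linarith
      qed
      have J1: "1 \<le> jap j powr \<eta>" using jap_ge_1 \<eta> by (intro ge_one_powr_ge_zero) auto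
      have "jap j powr \<tau> = (jap j powr \<eta>) powr (\<tau> / \<eta>)" using \<eta> by (simp add: powr_powr)
      also have "\<dots> \<le> (jap j powr \<eta>) powr \<sigma>" using \<sigma> J1 by (intro powr_mono) auto
      finally have "jap j powr \<tau> * \<bar>real_of_int (k j)\<bar> powr \<tau>
          \<le> (jap j powr \<eta>) powr \<sigma> * \<bar>real_of_int (k j)\<bar> powr \<sigma>"
        using \<sigma> n1 by (intro mult_mono powr_mono) auto
      also have "\<dots> = a j powr \<sigma>" unfolding a_def by (simp add: powr_mult)
      finally have "1 + jap j powr \<tau> * \<bar>real_of_int (k j)\<bar> powr \<tau> \<le> 2 * a j powr \<sigma>"
        using ge_one_powr_ge_zero[OF a1[OF j], of \<sigma>] \<sigma> by simp
      also have "\<dots> \<le> exp 1 * exp (\<sigma> * ln (a j))"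
        using a1[OF j] exp_ge_add_one_self[of 1] by (intro mult_mono) (auto simp: powr_def)
      also have "\<dots> = exp (1 + \<sigma> * ln (a j))" by (simp add: exp_add)
      also have "\<dots> \<le> exp (c0 * a j powr (1/4))"
      proof -
        have pos: "0 < a j" using a1[OF j] by simp
        have "ln (a j powr (1/4)) \<le> a j powr (1/4) - 1" using pos by (intro ln_le_minus_one) auto
        then have "ln (a j) \<le> 4 * a j powr (1/4)" using pos by (simp add: ln_powr)
        then have "\<sigma> * ln (a j) \<le> \<sigma> * (4 * a j powr (1/4))" using \<sigma> by (intro mult_left_mono) auto
        moreover have "1 \<le> a j powr (1/4)" using a1[OF j] by (intro ge_one_powr_ge_zero) auto
        ultimately show ?thesis by (simp add: c0_def algebra_simps)
      qed
      finally have le: "1 + jap j powr \<tau> * \<bar>real_of_int (k j)\<bar> powr \<tau> \<le> exp (c0 * a j powr (1/4))" .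
      have "0 < 1 + jap j powr \<tau> * \<bar>real_of_int (k j)\<bar> powr \<tau>"
        by (intro add_pos_nonneg mult_nonneg_nonneg) auto
      then show ?thesis using le by (simp add: exp_minus inverse_eq_divide divide_left_mono)
    qed
    have sum: "(\<Sum>j\<in>A. a j powr (1/4)) \<le> 2 * M powr \<beta>"
    proof -
      define A1 where "A1 = {j \<in> A. real j \<le> sqrt M}"
      define A2 where "A2 = {j \<in> A. sqrt M < real j}"
      have card: "real (card A1) \<le> sqrt M"
      proof -
        have "A1 \<subseteq> {1..nat \<lfloor>sqrt M\<rfloor>}"
          using j1 M1 by (auto simp: A1_def le_nat_floor)
        then have "card A1 \<le> nat \<lfloor>sqrt M\<rfloor>" using card_mono[of "{1..nat \<lfloor>sqrt M\<rfloor>}" A1] by simp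
        moreover have "real (nat \<lfloor>sqrt M\<rfloor>) \<le> sqrt M" using M1 by (intro of_nat_floor) simp
        ultimately show ?thesis by linarith
      qed
      have "(\<Sum>j\<in>A1. a j powr (1/4)) \<le> (\<Sum>j\<in>A1. M powr (1/4))"
        using aM a1 by (intro sum_mono powr_mono2) (auto simp: A1_def intro: order_trans[OF zero_le_one])
      also have "\<dots> = real (card A1) * M powr (1/4)" by simp
      also have "\<dots> \<le> sqrt M * M powr (1/4)" using card by (intro mult_right_mono) auto
      also have "sqrt M * M powr (1/4) = M powr (3/4)"
        using M1 by (simp add: powr_half_sqrt[symmetric] powr_add[symmetric])
      also have "\<dots> \<le> M powr \<beta>" using M1 by (intro powr_mono) (auto simp: \<beta>_def)
      finally have s1: "(\<Sum>j\<in>A1. a j powr (1/4)) \<le> M powr \<beta>" by simp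
      have "(\<Sum>j\<in>A2. a j powr (1/4)) \<le> (\<Sum>j\<in>A2. a j * M powr (- 3 * \<eta> / 8))"
      proof (rule sum_mono)
        fix j assume j: "j \<in> A2"
        then have jA: "j \<in> A" and big: "sqrt M < real j" by (auto simp: A2_def)
        have sM: "0 < sqrt M" using M1 by simp
        have "sqrt M powr \<eta> \<le> jap j powr \<eta> * 1"
          unfolding mult_1_right using big sM \<eta> by (intro powr_mono2) (auto simp: jap_def)
        also have "\<dots> \<le> a j"
        proof -
          have "k j \<noteq> 0" using jA by (simp add: A_def)
          then have "1 \<le> \<bar>real_of_int (k j)\<bar>" by linarith
          then show ?thesis unfolding a_def by (intro mult_left_mono) auto
        qed
        finally have "a j powr (- 3/4) \<le> (sqrt M powr \<eta>) powr (- 3/4)"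
          using sM a1[OF jA] by (intro powr_mono2') auto
        also have "\<dots> = M powr (- 3 * \<eta> / 8)"
          using M1 by (simp add: powr_half_sqrt[symmetric] powr_powr mult.commute)
        finally have "a j * a j powr (- 3/4) \<le> a j * M powr (- 3 * \<eta> / 8)"
          using a1[OF jA] by (intro mult_left_mono) auto
        moreover have "a j * a j powr (- 3/4) = a j powr (1 + (- 3/4))"
          using a1[OF jA] by (subst powr_add) auto
        ultimately show "a j powr (1/4) \<le> a j * M powr (- 3 * \<eta> / 8)" by simp
      qed
      also have "\<dots> = (\<Sum>j\<in>A2. a j) * M powr (- 3 * \<eta> / 8)" by (simp add: sum_distrib_right)
      also have "\<dots> \<le> M * M powr (- 3 * \<eta> / 8)"
        unfolding M using A by (intro mult_right_mono sum_mono2) (auto simp: A2_def a_def)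
      also have "\<dots> = M powr (1 + (- 3 * \<eta> / 8))" using M1 by (subst powr_add) auto
      also have "\<dots> \<le> M powr \<beta>" using M1 by (intro powr_mono) (auto simp: \<beta>_def)
      finally have s2: "(\<Sum>j\<in>A2. a j powr (1/4)) \<le> M powr \<beta>" .
      have "A = A1 \<union> A2" "A1 \<inter> A2 = {}" "finite A1" "finite A2" using A by (auto simp: A1_def A2_def)
      then have "(\<Sum>j\<in>A. a j powr (1/4)) = (\<Sum>j\<in>A1. a j powr (1/4)) + (\<Sum>j\<in>A2. a j powr (1/4))"
        by (simp add: sum.union_disjoint)
      then show ?thesis using s1 s2 by linarith
    qed
    have "exp (- (2 * c0 * M powr \<beta>)) \<le> exp (- (c0 * (\<Sum>j\<in>A. a j powr (1/4))))"
      using mult_left_mono[OF sum, of c0] c0 by simp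
    also have "\<dots> = (\<Prod>j\<in>A. exp (- (c0 * a j powr (1/4))))"
      by (simp add: sum_distrib_left sum_negf[symmetric] exp_sum[OF A])
    also have "\<dots> \<le> (\<Prod>j\<in>A. 1 / (1 + jap j powr \<tau> * \<bar>real_of_int (k j)\<bar> powr \<tau>))"
      using factor by (intro prod_mono) auto
    finally show "exp (- (2 * c0 * eta_norm \<eta> k powr \<beta>))
        \<le> (\<Prod>j | k j \<noteq> 0. 1 / (1 + jap j powr \<tau> * \<bar>real_of_int (k j)\<bar> powr \<tau>))"
      by (simp add: M_def A_def)
  qed (use c0 \<beta> in auto)
qed

section \<open>Sums of cone exponents along words\<close>

definition ksum :: "(nat \<Rightarrow> int) list \<Rightarrow> nat \<Rightarrow> int" where
  "ksum ks j = (\<Sum>k\<leftarrow>ks. k j)"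

definition degree :: "real \<Rightarrow> (nat \<Rightarrow> real) \<Rightarrow> (nat \<Rightarrow> int) \<Rightarrow> real" where
  "degree \<eta> w k = (\<Sum>\<^sub>\<infinity>j. jap j powr \<eta> * real_of_int (k j) * w j)"

lemma finite_support_ksum:
  assumes "\<And>k. k \<in> set ks \<Longrightarrow> finite {j. k j \<noteq> 0}"
  shows "finite {j. ksum ks j \<noteq> 0}"
  using assms
proof (induction ks)
  case Nil
  then show ?case by (simp add: ksum_def)
next
  case (Cons k ks)
  have "{j. ksum (k # ks) j \<noteq> 0} \<subseteq> {j. k j \<noteq> 0} \<union> {j. ksum ks j \<noteq> 0}"
    by (auto simp: ksum_def)
  then show ?case using Cons by (auto intro: finite_subset)
qed

lemma ksum_linear:
  assumes "\<And>k. k \<in> set ks \<Longrightarrow> finite {j. k j \<noteq> 0}"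
  shows "eta_norm \<eta> (ksum ks) \<le> wt (eta_norm \<eta>) ks"
    and "degree \<eta> w (ksum ks) = (\<Sum>k\<leftarrow>ks. degree \<eta> w k)"
    and "pairing (ksum ks) x = (\<Sum>k\<leftarrow>ks. pairing k x)"
proof -
  have "eta_norm \<eta> (ksum ks) \<le> wt (eta_norm \<eta>) ks \<and> degree \<eta> w (ksum ks) = (\<Sum>k\<leftarrow>ks. degree \<eta> w k)
      \<and> pairing (ksum ks) x = (\<Sum>k\<leftarrow>ks. pairing k x)"
    using assms
  proof (induction ks)
    case Nil
    then show ?case by (simp add: ksum_def eta_norm_def degree_def pairing_def)
  next
    case (Cons k ks)
    define A where "A = {j. k j \<noteq> 0} \<union> {j. ksum ks j \<noteq> 0}"
    have A: "finite A" using Cons.prems finite_support_ksum[of ks] by (simp add: A_def)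
    have s: "{j. ksum (k # ks) j \<noteq> 0} \<subseteq> A" "{j. k j \<noteq> 0} \<subseteq> A" "{j. ksum ks j \<noteq> 0} \<subseteq> A"
      by (auto simp: A_def ksum_def)
    have c: "ksum (k # ks) j = k j + ksum ks j" for j by (simp add: ksum_def)
    have deg: "degree \<eta> w l = (\<Sum>j\<in>A. jap j powr \<eta> * real_of_int (l j) * w j)" if "{j. l j \<noteq> 0} \<subseteq> A" for l
      unfolding degree_def using that A by (intro infsum_finite_support) auto
    have "eta_norm \<eta> (ksum (k # ks)) \<le> eta_norm \<eta> k + eta_norm \<eta> (ksum ks)"
      unfolding eta_norm_finite[OF A s(1)] eta_norm_finite[OF A s(2)] eta_norm_finite[OF A s(3)]
        sum.distrib[symmetric] distrib_left[symmetric] c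
      by (intro sum_mono mult_left_mono) auto
    moreover have "degree \<eta> w (ksum (k # ks)) = degree \<eta> w k + degree \<eta> w (ksum ks)"
      unfolding deg[OF s(1)] deg[OF s(2)] deg[OF s(3)] c by (simp add: algebra_simps sum.distrib)
    moreover have "pairing (ksum (k # ks)) x = pairing k x + pairing (ksum ks) x"
      unfolding pairing_finite[OF A s(1)] pairing_finite[OF A s(2)] pairing_finite[OF A s(3)] c
      by (simp add: algebra_simps sum.distrib)
    ultimately show ?case using Cons by simp
  qed
  then show "eta_norm \<eta> (ksum ks) \<le> wt (eta_norm \<eta>) ks"
    and "degree \<eta> w (ksum ks) = (\<Sum>k\<leftarrow>ks. degree \<eta> w k)"
    and "pairing (ksum ks) x = (\<Sum>k\<leftarrow>ks. pairing k x)" by auto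
qed

text \<open>This is where the cone enters: \<open>degree\<close> is additive and at least
  \<open>r * eta_norm \<eta> k > 0\<close> on every letter, so it is positive on the sum, which
  therefore cannot vanish.\<close>

lemma ksum_cone_in_Zstar:
  assumes \<eta>: "0 < \<eta>" and r: "0 < r" and ks: "ks \<in> lists (weighted_cone d \<eta> w r)" "ks \<noteq> []"
  shows "ksum ks \<in> Zstar d \<eta>"
proof -
  have Z: "k \<in> Zstar d \<eta>" if "k \<in> set ks" for k
    using that ks(1) by (auto simp: weighted_cone_def)
  have fin: "finite {j. k j \<noteq> 0}" if "k \<in> set ks" for k
    using finite_support_Zstar[OF \<eta> Z[OF that]] .
  have K: "finite {j. ksum ks j \<noteq> 0}" by (rule finite_support_ksum[OF fin])
  have pos: "0 < degree \<eta> w k" if "k \<in> set ks" for k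
  proof -
    have "0 < r * eta_norm \<eta> k" using r eta_norm_Zstar_ge_1[OF \<eta> Z[OF that]] by simp
    also have "\<dots> \<le> degree \<eta> w k" using that ks(1) by (auto simp: weighted_cone_def degree_def)
    finally show ?thesis .
  qed
  have "0 < (\<Sum>k\<leftarrow>ks. degree \<eta> w k)"
    using ks(2) pos
  proof (induction ks)
    case (Cons k ks)
    then show ?case by (cases "ks = []") (auto simp: add_pos_pos)
  qed simp
  then have "0 < degree \<eta> w (ksum ks)" using ksum_linear(2)[OF fin] by simp
  have "\<exists>j. ksum ks j \<noteq> 0"
  proof (rule ccontr)
    assume "\<not> ?thesis"
    then have "degree \<eta> w (ksum ks) = 0" by (simp add: degree_def)
    then show False using \<open>0 < degree \<eta> w (ksum ks)\<close> by simp
  qed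
  then have "1 \<le> eta_norm \<eta> (ksum ks)" using eta_norm_ge_1[OF \<eta> K] by blast
  moreover have "(\<lambda>j. jap j powr \<eta> * \<bar>real_of_int (ksum ks j)\<bar>) summable_on UNIV"
    by (rule iffD2[OF summable_on_cong_neutral summable_on_finite[OF K]]) auto
  moreover have "ksum ks \<in> tuples d UNIV"
  proof -
    have "ksum ks j = 0" if j: "j \<notin> indices d" for j
    proof -
      have "k j = 0" if "k \<in> set ks" for k using Z[OF that] j by (simp add: Zstar_def tuples_def)
      then show ?thesis unfolding ksum_def by (induction ks) auto
    qed
    then show ?thesis by (simp add: tuples_def)
  qed
  ultimately show ?thesis by (auto simp: Zstar_def)
qed

text \<open>The constants come from the Diophantine condition alone and are fixed before
  \<open>w\<close> and \<open>r\<close>, so the coupling threshold will not depend on the cone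
  weights.\<close>

lemma cone_small_divisors:
  assumes \<eta>: "0 < \<eta>" and \<tau>: "0 < \<tau>" and \<alpha>: "\<alpha> \<in> DC d \<eta> \<tau>"
  obtains B \<beta> where "0 < B" "0 < \<beta>" "\<beta> < 1"
    "\<And>w r. 0 < r \<Longrightarrow> small_divisors (weighted_cone d \<eta> w r) (eta_norm \<eta>) (\<lambda>k. cis (pairing k \<alpha>)) B \<beta>"
proof -
  obtain \<gamma> where \<gamma>: "0 < \<gamma>" "\<alpha> \<in> DC_gamma d \<eta> \<gamma> \<tau>" using \<alpha> by (auto simp: DC_def)
  show ?thesis
  proof (rule diophantine_product_bound[OF \<eta> \<tau>])
    fix c \<beta> assume c: "0 < c" and \<beta>: "0 < \<beta>" "\<beta> < (1 :: real)"
      and pb: "\<And>d k. k \<in> Zstar d \<eta> \<Longrightarrow> exp (- (c * eta_norm \<eta> k powr \<beta>))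
        \<le> (\<Prod>j | k j \<noteq> 0. 1 / (1 + jap j powr \<tau> * \<bar>real_of_int (k j)\<bar> powr \<tau>))"
    \<comment> \<open>Absorbs \<gamma> and the chord constant 3 into the exponent, which is possible
      because words have weight at least 1. The \<open>max 0\<close> covers \<gamma> > 3.\<close>
    define G where "G = max 0 (- ln (\<gamma> / 3))"
    have G: "0 \<le> G" "exp (- G) \<le> \<gamma> / 3"
    proof -
      have "exp (- G) \<le> exp (ln (\<gamma> / 3))" unfolding exp_le_cancel_iff by (simp add: G_def)
      then show "exp (- G) \<le> \<gamma> / 3" using \<gamma> by simp
    qed (simp add: G_def)
    show ?thesis
    proof (rule that[of "c + G" \<beta>])
      fix w r assume r: "0 < (r :: real)"
      show "small_divisors (weighted_cone d \<eta> w r) (eta_norm \<eta>) (\<lambda>k. cis (pairing k \<alpha>)) (c + G) \<beta>"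
      proof
        show "1 \<le> eta_norm \<eta> k" if "k \<in> weighted_cone d \<eta> w r" for k
          using that eta_norm_Zstar_ge_1[OF \<eta>] by (auto simp: weighted_cone_def)
        show "cmod (cis (pairing k \<alpha>)) = 1" for k by simp
        fix ks assume ks: "ks \<in> lists (weighted_cone d \<eta> w r)" "ks \<noteq> []"
        define K where "K = ksum ks"
        have fin: "finite {j. k j \<noteq> 0}" if "k \<in> set ks" for k
          using that ks(1) finite_support_Zstar[OF \<eta>, of k d] by (auto simp: weighted_cone_def)
        have K: "K \<in> Zstar d \<eta>" unfolding K_def by (rule ksum_cone_in_Zstar[OF \<eta> r ks])
        have M1: "1 \<le> eta_norm \<eta> K" by (rule eta_norm_Zstar_ge_1[OF \<eta> K])
        have freq: "freq (\<lambda>k. cis (pairing k \<alpha>)) ks = cis (pairing K \<alpha>)"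
        proof -
          have "freq (\<lambda>k. cis (pairing k \<alpha>)) ks = cis (\<Sum>k\<leftarrow>ks. pairing k \<alpha>)"
            by (induction ks) (simp_all add: cis_mult)
          then show ?thesis by (simp add: K_def ksum_linear(3)[OF fin])
        qed
        define X where "X = wt (eta_norm \<eta>) ks powr \<beta>"
        have MX: "eta_norm \<eta> K powr \<beta> \<le> X" "1 \<le> X"
        proof -
          have "eta_norm \<eta> K \<le> wt (eta_norm \<eta>) ks" unfolding K_def by (rule ksum_linear(1)[OF fin])
          then show le: "eta_norm \<eta> K powr \<beta> \<le> X" unfolding X_def using M1 \<beta> by (intro powr_mono2) auto
          have "1 \<le> eta_norm \<eta> K powr \<beta>" using M1 \<beta> by (intro ge_one_powr_ge_zero) auto
          then show "1 \<le> X" using le by linarith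
        qed
        have "exp (- ((c + G) * X)) = exp (- (G * X)) * exp (- (c * X))"
          by (simp add: exp_add[symmetric] algebra_simps)
        also have "\<dots> \<le> exp (- G) * exp (- (c * eta_norm \<eta> K powr \<beta>))"
          using MX G(1) c mult_left_mono[of 1 X G] by (intro mult_mono) auto
        also have "\<dots> \<le> \<gamma> / 3 * (\<Prod>j | K j \<noteq> 0. 1 / (1 + jap j powr \<tau> * \<bar>real_of_int (K j)\<bar> powr \<tau>))"
          using G(2) pb[OF K] \<gamma> by (intro mult_mono) auto
        also have "\<dots> \<le> (INF n::int. \<bar>pairing K \<alpha> - 2 * pi * real_of_int n\<bar>) / 3"
          using \<gamma>(2) K by (auto simp: DC_gamma_def)
        also have "\<dots> \<le> cmod (cis (pairing K \<alpha>) - 1)"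
          using INF_dist_2pi_le[of "pairing K \<alpha>"] by simp
        finally show "exp (- ((c + G) * wt (eta_norm \<eta>) ks powr \<beta>))
            \<le> cmod (freq (\<lambda>k. cis (pairing k \<alpha>)) ks - 1)"
          unfolding freq X_def .
      qed
    qed (use c G \<beta> in auto)
  qed
qed

theorem theorem1p2:
  fixes d :: enat and \<eta> h r \<tau> N :: real and \<alpha> :: "nat \<Rightarrow> real"
  assumes "1 \<le> d" and "0 < \<eta>" and "0 < h" and "0 < r" and "r \<le> 1" and "1 < \<tau>"
    and "\<alpha> \<in> DC d \<eta> \<tau>"
  shows "\<exists>l0>0. \<forall>w v vhat.
      weights d w \<longrightarrow>
      C_omega d \<eta> h v vhat \<longrightarrow>
      (\<forall>k. k \<notin> weighted_cone d \<eta> w r \<longrightarrow> vhat k = 0) \<longrightarrow>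
      coeff_norm d \<eta> h vhat = N \<longrightarrow>
      (\<forall>l::real. \<bar>l\<bar> < l0 \<longrightarrow>
        (\<forall>x\<in>tuples d (UNIV :: real set).
          spectrum (schroedinger (\<lambda>y. complex_of_real l * v y) \<alpha> x) = complex_of_real ` {-2..2}))"
proof (rule cone_small_divisors[OF assms(2) _ assms(7)])
  show "0 < \<tau>" using assms by simp
  fix B \<beta> assume B: "0 < B" and \<beta>: "0 < \<beta>" "\<beta> < (1 :: real)"
    and sd: "\<And>w r. 0 < r \<Longrightarrow> small_divisors (weighted_cone d \<eta> w r) (eta_norm \<eta>) (\<lambda>k. cis (pairing k \<alpha>)) B \<beta>"
  show ?thesis
  proof (rule abs_summable_wcoef[OF B \<beta> assms(3)])
    fix l0 :: real
    assume l0: "0 < l0" and main: "\<And>S s w f l a b D. \<lbrakk>small_divisors (S :: (nat \<Rightarrow> int) set) s w B \<beta>;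
        (\<lambda>k. cmod (f k) * exp (h * s k)) summable_on S; (\<Sum>\<^sub>\<infinity>k\<in>S. cmod (f k) * exp (h * s k)) \<le> N;
        \<bar>l\<bar> < l0; small_divisors.apart S s w (h / 4) a; small_divisors.apart S s w (h / 4) b;
        \<And>y. cmod y = 1 \<Longrightarrow> min 1 (cmod (y - a)) * min 1 (cmod (y - b)) \<le> 2 * cmod (D y)\<rbrakk>
      \<Longrightarrow> wcoef (\<lambda>k. complex_of_real l * f k) w D abs_summable_on lists S"
    show ?thesis
    proof (intro exI[of _ l0] conjI l0 allI impI ballI)
      fix w v vhat and l :: real and x
      assume an: "C_omega d \<eta> h v vhat" and supp: "\<forall>k. k \<notin> weighted_cone d \<eta> w r \<longrightarrow> vhat k = 0"
        and N: "coeff_norm d \<eta> h vhat = N" and l: "\<bar>l\<bar> < l0" and x: "x \<in> tuples d (UNIV :: real set)"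
      define S where "S = weighted_cone d \<eta> w r"
      define Z where "Z = Zstar d \<eta> \<union> {\<lambda>_. 0}"
      define \<omega> where "\<omega> = (\<lambda>k. cis (pairing k \<alpha>))"
      \<comment> \<open>The phase \<open>x\<close> only rotates the Fourier coefficients, so norms
        and hence \<open>l0\<close> do not see it.\<close>
      define f where "f = (\<lambda>k. vhat k * cis (pairing k x))"
      define g where "g = (\<lambda>k. complex_of_real l * f k)"
      have SZ: "S \<subseteq> Z" by (auto simp: S_def Z_def weighted_cone_def)
      have vS: "vhat k = 0" if "k \<notin> S" for k using supp that by (simp add: S_def)
      have fin: "finite {j. k j \<noteq> 0}" if "k \<in> S" for k
        using that finite_support_Zstar[OF assms(2), of k d] by (auto simp: S_def weighted_cone_def)
      interpret small_divisors S "eta_norm \<eta>" \<omega> B \<beta>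
        unfolding S_def \<omega>_def by (rule sd[OF assms(4)])
      have sdS: "small_divisors S (eta_norm \<eta>) \<omega> B \<beta>" by unfold_locales
      have hsZ: "((\<lambda>k. cmod (vhat k) * exp (h * eta_norm \<eta> k)) has_sum N) Z"
        using an N by (simp add: C_omega_def coeff_norm_def Z_def has_sum_iff)
      have hs: "((\<lambda>k. cmod (f k) * exp (h * eta_norm \<eta> k)) has_sum N) S"
        by (rule iffD1[OF has_sum_cong_neutral hsZ]) (use SZ vS in \<open>auto simp: f_def norm_mult\<close>)
      have fs: "f abs_summable_on S"
      proof (rule Infinite_Sum.abs_summable_on_comparison_test'[OF has_sum_imp_summable[OF hs]])
        fix k assume "k \<in> S"
        then have "1 \<le> eta_norm \<eta> k" by (rule s_ge_1)
        then have "1 \<le> exp (h * eta_norm \<eta> k)" using assms(3) by simp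
        then show "cmod (f k) \<le> cmod (f k) * exp (h * eta_norm \<eta> k)"
          using mult_left_mono[of 1 "exp (h * eta_norm \<eta> k)" "cmod (f k)"] by simp
      qed
      interpret one_sided S "eta_norm \<eta>" \<omega> B \<beta> g "h / 4"
      proof
        show "g abs_summable_on S"
          unfolding g_def norm_mult by (intro summable_on_cmult_right fs)
        fix a b D assume ap: "apart (h / 4) a" "apart (h / 4) b"
          and D: "\<And>y. cmod y = 1 \<Longrightarrow> min 1 (cmod (y - a)) * min 1 (cmod (y - b)) \<le> 2 * cmod (D y)"
        show "wcoef g \<omega> D abs_summable_on lists S"
          unfolding g_def
          by (rule main[OF sdS has_sum_imp_summable[OF hs] eq_refl[OF infsumI[OF hs]] l ap D])
      qed (use B \<beta> assms in auto)
      have pot: "V n = complex_of_real l * v (\<lambda>j. complex_of_real (x j + real_of_int n * \<alpha> j))" for n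
      proof -
        define y where "y = (\<lambda>j. complex_of_real (x j + real_of_int n * \<alpha> j))"
        \<comment> \<open>The strip consists of tuples vanishing off the index set, so the whole
          orbit of \<open>x\<close> has to vanish there.\<close>
        have \<alpha>0: "\<alpha> j = 0" if "j \<notin> indices d" for j
          using that assms(7) by (auto simp: DC_def DC_gamma_def tuples_def)
        have "0 < h * jap j powr \<eta>" for j using jap_ge_1[of j] assms(3) by simp
        then have "y \<in> strip d \<eta> h"
          using x \<alpha>0 by (simp add: strip_def tuples_def y_def)
        then have "((\<lambda>k. vhat k * exp (\<i> * pairing k y)) has_sum v y) Z"
          using an by (simp add: C_omega_def Z_def)
        then have "((\<lambda>k. f k * \<omega> k powi n) has_sum v y) S"
        proof (rule iffD1[OF has_sum_cong_neutral, rotated -1])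
          fix k assume "k \<in> Z \<inter> S"
          then have A: "finite {j. k j \<noteq> 0}" using fin by auto
          have eq: "pairing k y = complex_of_real (pairing k x + real_of_int n * pairing k \<alpha>)"
            unfolding pairing_finite[OF A subset_refl]
            by (simp add: y_def algebra_simps sum.distrib sum_distrib_left)
          show "vhat k * exp (\<i> * pairing k y) = f k * \<omega> k powi n"
            unfolding eq cis_conv_exp[symmetric]
            by (simp add: f_def \<omega>_def cis_power_int cis_mult)
        qed (use SZ vS in \<open>auto simp: f_def\<close>)
        then have "((\<lambda>k. g k * \<omega> k powi n) has_sum (complex_of_real l * v y)) S"
          unfolding g_def mult.assoc by (rule has_sum_cmult_right)
        then show ?thesis unfolding V_def y_def by (rule infsumI)
      qed
      have "schroedinger (\<lambda>y. complex_of_real l * v y) \<alpha> x = H"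
        by (simp add: fun_eq_iff schroedinger_def H_def pot)
      then show "spectrum (schroedinger (\<lambda>y. complex_of_real l * v y) \<alpha> x) = complex_of_real ` {-2..2}"
        by (simp add: spectrum_H)
    qed
  qed
qed

end
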